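(* Let $X$ and $Y$ be complex infinite-dimensional Banach spaces, $A\in B(X)$, $B\in B(Y)$, $C\in B(Y,X)$, and let $M_C=\begin{pmatrix}A&C\\0&B\end{pmatrix}\in B(X\oplus Y)$. Then $$\sigma_{lw}(M_C)\cup\bigl(S(A)\cap S(B^* )\bigr)\cup S(A^* )=\sigma_{lw}(A)\cup\sigma_{lw}(B)\cup\bigl(S(A)\cap S(B^* )\bigr)\cup S(A^* ).$$
   Context: $B(Y,X)$ is the set of bounded linear operators from $Y$ to $X$, and $B(X)=B(X,X)$. $T^*$ denotes the dual operator of $T$ acting on the dual space. For $T\in B(X)$ let $\alpha(T)=\dim N(T)$ and $\beta(T)=\dim X/R(T)$, where $N(T)$ and $R(T)$ are the kernel and range; for semi-Fredholm $T$, $\mathrm{ind}(T)=\alpha(T)-\beta(T)$. $\Phi_l(X)=\{T\in B(X): R(T)\text{ is a closed and complemented subspace of }X\text{ and }\alpha(T)<\infty\}$ and $\Phi_{lw}(X)=\{T\in\Phi_l(X):\mathrm{ind}(T)\le 0\}$. The left semi-Weyl spectrum is $\sigma_{lw}(T)=\{\lambda\in\mathbb{C}:T-\lambda I\notin\Phi_{lw}(X)\}$; similarly on $Y$ and $X\oplus Y$. $T$ has the single valued extension property (SVEP) at $\lambda\in\mathbb{C}$ if there is $r>0$ such that for every open subset $V$ of the open disc $D(\lambda,r)$, the function $f\equiv 0$ is the only analytic solution of $(T-\mu)f(\mu)=0$ for all $\mu\in V$. $S(T)=\{\lambda\in\mathbb{C}: T\text{ fails to have the SVEP at }\lambda\}$.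 *)

theory Defs
  imports "HOL-Analysis.Analysis"
begin

section \<open>Complex normed spaces and Banach spaces\<close>

class complex_normed_vector = real_normed_vector +
  fixes scaleC :: "complex \<Rightarrow> 'a \<Rightarrow> 'a"  (infixr \<open>*\<^sub>C\<close> 75)
  assumes scaleC_add_right: "a *\<^sub>C (x + y) = a *\<^sub>C x + a *\<^sub>C y"
    and scaleC_add_left: "(a + b) *\<^sub>C x = a *\<^sub>C x + b *\<^sub>C x"
    and scaleC_scaleC: "a *\<^sub>C b *\<^sub>C x = (a * b) *\<^sub>C x"
    and scaleR_scaleC: "r *\<^sub>R x = complex_of_real r *\<^sub>C x"
    and norm_scaleC: "norm (a *\<^sub>C x) = cmod a * norm x"

class cbanach = complex_normed_vector + banach

lemma scaleC_one: "1 *\<^sub>C x = (x :: 'a::complex_normed_vector)"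
  using scaleR_scaleC[of 1 x] by simp

global_interpretation complex_vector:
  vector_space "scaleC :: complex \<Rightarrow> 'a \<Rightarrow> 'a::complex_normed_vector"
  defines cdependent_raw_def: cdependent = complex_vector.dependent
    and csubspace_raw_def: csubspace = complex_vector.subspace
    and cspan_raw_def: cspan = complex_vector.span
    and cdim_raw_def: cdim = complex_vector.dim
  by unfold_locales (simp_all add: scaleC_add_right scaleC_add_left scaleC_scaleC scaleC_one)

instantiation complex :: complex_normed_vector
begin
definition scaleC_complex :: "complex \<Rightarrow> complex \<Rightarrow> complex"
  where "scaleC_complex a x = a * x"
instance
  by standard (simp_all add: scaleC_complex_def algebra_simps scaleR_conv_of_real norm_mult)
end

instance complex :: cbanach ..

text \<open>The direct sum of two spaces is the product type, which carries the norm
  \<open>sqrt (norm x ^ 2 + norm y ^ 2)\<close>.\<close>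

instantiation prod :: (complex_normed_vector, complex_normed_vector) complex_normed_vector
begin
definition scaleC_prod :: "complex \<Rightarrow> 'a \<times> 'b \<Rightarrow> 'a \<times> 'b"
  where "scaleC_prod a p = (a *\<^sub>C fst p, a *\<^sub>C snd p)"
instance
proof
  fix a b :: complex and x y :: "'a \<times> 'b" and r :: real
  show "a *\<^sub>C (x + y) = a *\<^sub>C x + a *\<^sub>C y" "(a + b) *\<^sub>C x = a *\<^sub>C x + b *\<^sub>C x"
    "a *\<^sub>C b *\<^sub>C x = (a * b) *\<^sub>C x"
    by (simp_all add: scaleC_prod_def scaleC_add_right scaleC_add_left scaleC_scaleC)
  show "r *\<^sub>R x = complex_of_real r *\<^sub>C x"
    by (simp add: scaleC_prod_def scaleR_prod_def scaleR_scaleC)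
  show "norm (a *\<^sub>C x) = cmod a * norm x"
    by (simp add: scaleC_prod_def norm_prod_def norm_scaleC power_mult_distrib
        flip: distrib_left) (simp add: real_sqrt_mult)
qed
end

instance prod :: (cbanach, cbanach) cbanach ..


section \<open>Bounded complex-linear operators\<close>

text \<open>The complex counterpart of the type of bounded real-linear maps, from which it inherits the
  operator norm.\<close>

typedef (overloaded) ('a, 'b) cblinfun  (\<open>(_ \<Rightarrow>\<^sub>C\<^sub>L /_)\<close> [22, 21] 21) =
  "{f :: 'a::complex_normed_vector \<Rightarrow>\<^sub>L 'b::complex_normed_vector.
      \<forall>c x. blinfun_apply f (c *\<^sub>C x) = c *\<^sub>C blinfun_apply f x}"
  morphisms blinfun_of_cblinfun CBlinfun
  by (rule exI[of _ 0]) (use complex_vector.scale_zero_right in auto)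

setup_lifting type_definition_cblinfun

definition cblinfun_apply :: "('a::complex_normed_vector \<Rightarrow>\<^sub>C\<^sub>L 'b::complex_normed_vector) \<Rightarrow> 'a \<Rightarrow> 'b"
  where "cblinfun_apply T = blinfun_apply (blinfun_of_cblinfun T)"

declare [[coercion
  "cblinfun_apply :: ('a::complex_normed_vector \<Rightarrow>\<^sub>C\<^sub>L 'b::complex_normed_vector) \<Rightarrow> 'a \<Rightarrow> 'b"]]

definition mk_cblinfun :: "('a \<Rightarrow> 'b) \<Rightarrow> ('a::complex_normed_vector \<Rightarrow>\<^sub>C\<^sub>L 'b::complex_normed_vector)"
  where "mk_cblinfun f = CBlinfun (Blinfun f)"

lemma cblinfun_eqI: "(\<And>x. cblinfun_apply S x = cblinfun_apply T x) \<Longrightarrow> S = T"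
  by (metis blinfun_eqI blinfun_of_cblinfun_inject cblinfun_apply_def)

lemma bounded_linear_cblinfun: "bounded_linear (cblinfun_apply T)"
  by (simp add: cblinfun_apply_def blinfun.bounded_linear_right)

lemma cblinfun_scaleC: "cblinfun_apply T (c *\<^sub>C x) = c *\<^sub>C cblinfun_apply T x"
  unfolding cblinfun_apply_def using blinfun_of_cblinfun[of T] by blast

lemma mk_cblinfun_apply:
  assumes "bounded_linear f" "\<And>c x. f (c *\<^sub>C x) = c *\<^sub>C f x"
  shows "cblinfun_apply (mk_cblinfun f) x = f x"
  using assms
  by (simp add: cblinfun_apply_def mk_cblinfun_def CBlinfun_inverse bounded_linear_Blinfun_apply)

lemma bounded_linear_scaleC: "bounded_linear (\<lambda>x :: 'a::complex_normed_vector. c *\<^sub>C x)"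
  by (rule bounded_linear_intro[where K = "cmod c"])
    (simp_all add: scaleC_add_right scaleR_scaleC scaleC_scaleC norm_scaleC mult.commute)

instantiation cblinfun :: (complex_normed_vector, complex_normed_vector) complex_normed_vector
begin

lift_definition zero_cblinfun :: "'a \<Rightarrow>\<^sub>C\<^sub>L 'b" is 0
  using complex_vector.scale_zero_right by auto

lift_definition plus_cblinfun :: "('a \<Rightarrow>\<^sub>C\<^sub>L 'b) \<Rightarrow> ('a \<Rightarrow>\<^sub>C\<^sub>L 'b) \<Rightarrow> ('a \<Rightarrow>\<^sub>C\<^sub>L 'b)" is "(+)"
  by (simp add: plus_blinfun.rep_eq scaleC_add_right)

lift_definition minus_cblinfun :: "('a \<Rightarrow>\<^sub>C\<^sub>L 'b) \<Rightarrow> ('a \<Rightarrow>\<^sub>C\<^sub>L 'b) \<Rightarrow> ('a \<Rightarrow>\<^sub>C\<^sub>L 'b)" is "(-)"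
  by (simp add: minus_blinfun.rep_eq complex_vector.scale_right_diff_distrib)

lift_definition uminus_cblinfun :: "('a \<Rightarrow>\<^sub>C\<^sub>L 'b) \<Rightarrow> ('a \<Rightarrow>\<^sub>C\<^sub>L 'b)" is uminus
  by (simp add: uminus_blinfun.rep_eq complex_vector.scale_minus_right)

lift_definition scaleR_cblinfun :: "real \<Rightarrow> ('a \<Rightarrow>\<^sub>C\<^sub>L 'b) \<Rightarrow> ('a \<Rightarrow>\<^sub>C\<^sub>L 'b)" is scaleR
  by (simp add: scaleR_blinfun.rep_eq scaleR_scaleC scaleC_scaleC mult.commute)

lift_definition scaleC_cblinfun :: "complex \<Rightarrow> ('a \<Rightarrow>\<^sub>C\<^sub>L 'b) \<Rightarrow> ('a \<Rightarrow>\<^sub>C\<^sub>L 'b)"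
  is "\<lambda>c f. Blinfun (\<lambda>x. c *\<^sub>C blinfun_apply f x)"
  by (subst (1 2) bounded_linear_Blinfun_apply)
    (auto intro!: bounded_linear_compose[OF bounded_linear_scaleC] blinfun.bounded_linear_right
      simp: scaleC_scaleC mult.commute)

lift_definition norm_cblinfun :: "('a \<Rightarrow>\<^sub>C\<^sub>L 'b) \<Rightarrow> real" is norm .

lift_definition dist_cblinfun :: "('a \<Rightarrow>\<^sub>C\<^sub>L 'b) \<Rightarrow> ('a \<Rightarrow>\<^sub>C\<^sub>L 'b) \<Rightarrow> real" is dist .

definition sgn_cblinfun :: "('a \<Rightarrow>\<^sub>C\<^sub>L 'b) \<Rightarrow> ('a \<Rightarrow>\<^sub>C\<^sub>L 'b)"
  where "sgn_cblinfun f = scaleR (inverse (norm f)) f"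

definition uniformity_cblinfun :: "(('a \<Rightarrow>\<^sub>C\<^sub>L 'b) \<times> ('a \<Rightarrow>\<^sub>C\<^sub>L 'b)) filter"
  where "uniformity_cblinfun = (INF e\<in>{0 <..}. principal {(x, y). dist x y < e})"

definition open_cblinfun :: "('a \<Rightarrow>\<^sub>C\<^sub>L 'b) set \<Rightarrow> bool"
  where "open_cblinfun S \<longleftrightarrow> (\<forall>x\<in>S. \<forall>\<^sub>F (x', y) in uniformity. x' = x \<longrightarrow> y \<in> S)"

lemma blinfun_apply_scaleC:
  "blinfun_apply (Blinfun (\<lambda>x. c *\<^sub>C blinfun_apply f x)) x = c *\<^sub>C blinfun_apply f x"
  for f :: "'a::complex_normed_vector \<Rightarrow>\<^sub>L 'b::complex_normed_vector"
  by (subst bounded_linear_Blinfun_apply)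
    (auto intro!: bounded_linear_compose[OF bounded_linear_scaleC] blinfun.bounded_linear_right)

instance
proof
  fix f g h :: "'a \<Rightarrow>\<^sub>C\<^sub>L 'b" and r s :: real and a b :: complex
  show "f + g + h = f + (g + h)" "f + g = g + f" "0 + f = f" "- f + f = 0" "f - g = f + - g"
    by (transfer; simp)+
  show "r *\<^sub>R (f + g) = r *\<^sub>R f + r *\<^sub>R g" "(r + s) *\<^sub>R f = r *\<^sub>R f + s *\<^sub>R f"
    "r *\<^sub>R s *\<^sub>R f = (r * s) *\<^sub>R f" "1 *\<^sub>R f = f"
    by (transfer; simp add: algebra_simps)+
  show "dist f g = norm (f - g)"
    by transfer (rule dist_norm)
  show "sgn f = scaleR (inverse (norm f)) f"
    by (rule sgn_cblinfun_def)
  show "norm f = 0 \<longleftrightarrow> f = 0" "norm (f + g) \<le> norm f + norm g" "norm (r *\<^sub>R f) = \<bar>r\<bar> * norm f"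
    by (transfer; simp add: norm_triangle_ineq)+
  have scaleC_apply: "blinfun_apply (blinfun_of_cblinfun (c *\<^sub>C F)) x
      = c *\<^sub>C blinfun_apply (blinfun_of_cblinfun F) x" for c x and F :: "'a \<Rightarrow>\<^sub>C\<^sub>L 'b"
    by (simp add: scaleC_cblinfun.rep_eq blinfun_apply_scaleC)
  show "a *\<^sub>C (f + g) = a *\<^sub>C f + a *\<^sub>C g" "(a + b) *\<^sub>C f = a *\<^sub>C f + b *\<^sub>C f"
    "a *\<^sub>C b *\<^sub>C f = (a * b) *\<^sub>C f" "r *\<^sub>R f = complex_of_real r *\<^sub>C f"
    by (rule cblinfun_eqI, simp add: cblinfun_apply_def scaleC_apply
        plus_cblinfun.rep_eq scaleR_cblinfun.rep_eq plus_blinfun.rep_eq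
        scaleR_blinfun.rep_eq scaleC_add_right scaleC_add_left scaleC_scaleC scaleR_scaleC)+
  show "norm (a *\<^sub>C f) = cmod a * norm f"
  proof transfer
    fix a :: complex and f :: "'a \<Rightarrow>\<^sub>L 'b"
    let ?g = "\<lambda>c f. Blinfun (\<lambda>x. c *\<^sub>C blinfun_apply f x) :: 'a \<Rightarrow>\<^sub>L 'b"
    have le: "norm (?g c f) \<le> cmod c * norm f" for c f
    proof (rule norm_blinfun_bound)
      fix x
      show "norm (?g c f x) \<le> cmod c * norm f * norm x"
        using mult_left_mono[OF norm_blinfun[of f x], of "cmod c"]
        by (simp add: blinfun_apply_scaleC norm_scaleC mult.assoc)
    qed simp
    show "norm (?g a f) = cmod a * norm f"
    proof (cases "a = 0")
      case True
      then show ?thesis using le[of a f] by simp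
    next
      case False
      have "?g (inverse a) (?g a f) = f"
        using False by (auto intro!: blinfun_eqI simp: blinfun_apply_scaleC scaleC_scaleC scaleC_one blinfun_apply_inverse)
      then have "norm f \<le> cmod (inverse a) * norm (?g a f)"
        using le[of "inverse a" "?g a f"] by simp
      then have "cmod a * norm f \<le> norm (?g a f)"
        using False by (simp add: norm_divide field_simps)
      then show ?thesis using le[of a f] by simp
    qed
  qed
qed (simp_all add: uniformity_cblinfun_def open_cblinfun_def)

end

lemma cblinfun_apply_simps:
  "cblinfun_apply 0 x = 0"
  "cblinfun_apply (S + T) x = cblinfun_apply S x + cblinfun_apply T x"
  "cblinfun_apply (S - T) x = cblinfun_apply S x - cblinfun_apply T x"
  "cblinfun_apply (- T) x = - cblinfun_apply T x"
  "cblinfun_apply (c *\<^sub>C T) x = c *\<^sub>C cblinfun_apply T x"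
  by (simp_all add: cblinfun_apply_def zero_cblinfun.rep_eq plus_cblinfun.rep_eq
      minus_cblinfun.rep_eq uminus_cblinfun.rep_eq scaleC_cblinfun.rep_eq blinfun_apply_scaleC
      blinfun.bilinear_simps)

instance cblinfun :: (complex_normed_vector, cbanach) cbanach
proof
  fix X :: "nat \<Rightarrow> 'a \<Rightarrow>\<^sub>C\<^sub>L 'b"
  assume "Cauchy X"
  then have "Cauchy (\<lambda>n. blinfun_of_cblinfun (X n))"
    by (simp add: Cauchy_def dist_cblinfun.rep_eq)
  then obtain L where L: "(\<lambda>n. blinfun_of_cblinfun (X n)) \<longlonglongrightarrow> L"
    by (auto simp: Cauchy_convergent_iff convergent_def)
  have lim: "(\<lambda>n. blinfun_apply (blinfun_of_cblinfun (X n)) x) \<longlonglongrightarrow> blinfun_apply L x" for x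
    using L by (intro blinfun.tendsto tendsto_const)
  have "blinfun_apply L (c *\<^sub>C x) = c *\<^sub>C blinfun_apply L x" for c x
  proof (rule LIMSEQ_unique[OF lim])
    show "(\<lambda>n. blinfun_apply (blinfun_of_cblinfun (X n)) (c *\<^sub>C x)) \<longlonglongrightarrow> c *\<^sub>C blinfun_apply L x"
      using bounded_linear.tendsto[OF bounded_linear_scaleC lim, of c x]
      by (simp add: cblinfun_scaleC[unfolded cblinfun_apply_def])
  qed
  then have "blinfun_of_cblinfun (CBlinfun L) = L"
    by (simp add: CBlinfun_inverse)
  then have "X \<longlonglongrightarrow> CBlinfun L"
    using L by (simp add: tendsto_dist_iff[of X] tendsto_dist_iff[of "\<lambda>n. blinfun_of_cblinfun (X n)"]
        dist_cblinfun.rep_eq)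
  then show "convergent X"
    by (rule convergentI)
qed

definition cid :: "'a::complex_normed_vector \<Rightarrow>\<^sub>C\<^sub>L 'a"
  where "cid = mk_cblinfun (\<lambda>x. x)"

lemma cid_apply: "cblinfun_apply cid x = x"
  by (simp add: cid_def mk_cblinfun_apply)

type_synonym 'a cdual = "'a \<Rightarrow>\<^sub>C\<^sub>L complex"

definition dual_op :: "('a::complex_normed_vector \<Rightarrow>\<^sub>C\<^sub>L 'b::complex_normed_vector)
    \<Rightarrow> ('b cdual \<Rightarrow>\<^sub>C\<^sub>L 'a cdual)"
  where "dual_op T = mk_cblinfun (\<lambda>f. mk_cblinfun (\<lambda>x. cblinfun_apply f (cblinfun_apply T x)))"

lemma norm_cblinfun_bound:
  assumes "0 \<le> b" "\<And>x. norm (cblinfun_apply T x) \<le> b * norm x"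
  shows "norm T \<le> b"
  using assms by (simp add: cblinfun_apply_def norm_cblinfun.rep_eq norm_blinfun_bound)

lemma norm_cblinfun_apply: "norm (cblinfun_apply T x) \<le> norm T * norm x"
  by (simp add: cblinfun_apply_def norm_cblinfun.rep_eq norm_blinfun)

lemma dual_op_apply: "cblinfun_apply (cblinfun_apply (dual_op T) f) x = cblinfun_apply f (cblinfun_apply T x)"
proof -
  define D where "D f = mk_cblinfun (\<lambda>x. cblinfun_apply f (cblinfun_apply T x))" for f :: "'b cdual"
  have c: "cblinfun_apply (D f) x = cblinfun_apply f (cblinfun_apply T x)" for f x
    unfolding D_def by (rule mk_cblinfun_apply)
      (auto intro: bounded_linear_compose[OF bounded_linear_cblinfun bounded_linear_cblinfun]
        simp: cblinfun_scaleC)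
  have "bounded_linear D"
  proof (rule bounded_linear_intro[where K = "norm T"])
    show "D (f + g) = D f + D g" for f g
      by (rule cblinfun_eqI) (simp add: c cblinfun_apply_simps)
    show "D (r *\<^sub>R f) = r *\<^sub>R D f" for r f
      by (rule cblinfun_eqI) (simp add: c cblinfun_apply_simps scaleR_scaleC)
    show "norm (D f) \<le> norm f * norm T" for f
    proof (rule norm_cblinfun_bound)
      fix x
      have "norm (cblinfun_apply f (cblinfun_apply T x)) \<le> norm f * (norm T * norm x)"
        by (rule order_trans[OF norm_cblinfun_apply mult_left_mono[OF norm_cblinfun_apply]]) simp
      then show "norm (cblinfun_apply (D f) x) \<le> norm f * norm T * norm x"
        by (simp add: c mult.assoc)
    qed simp
  qed
  moreover have "D (a *\<^sub>C f) = a *\<^sub>C D f" for a f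
    by (rule cblinfun_eqI) (simp add: c cblinfun_apply_simps)
  ultimately have "cblinfun_apply (dual_op T) f = D f"
    unfolding dual_op_def D_def by (rule mk_cblinfun_apply)
  then show ?thesis by (simp add: c)
qed

definition upper_triangular :: "('x::complex_normed_vector \<Rightarrow>\<^sub>C\<^sub>L 'x)
    \<Rightarrow> ('y::complex_normed_vector \<Rightarrow>\<^sub>C\<^sub>L 'x) \<Rightarrow> ('y \<Rightarrow>\<^sub>C\<^sub>L 'y) \<Rightarrow> (('x \<times> 'y) \<Rightarrow>\<^sub>C\<^sub>L ('x \<times> 'y))"
  where "upper_triangular A C B =
    mk_cblinfun (\<lambda>(x, y). (cblinfun_apply A x + cblinfun_apply C y, cblinfun_apply B y))"

lemma upper_triangular_apply:
  "cblinfun_apply (upper_triangular A C B) (x, y) =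
    (cblinfun_apply A x + cblinfun_apply C y, cblinfun_apply B y)"
proof -
  let ?f = "\<lambda>(x, y). (cblinfun_apply A x + cblinfun_apply C y, cblinfun_apply B y)"
  have "bounded_linear ?f"
    unfolding case_prod_unfold
    by (intro bounded_linear_Pair bounded_linear_add
        bounded_linear_compose[OF bounded_linear_cblinfun] bounded_linear_fst bounded_linear_snd)
  then show ?thesis
    unfolding upper_triangular_def
    by (subst mk_cblinfun_apply)
      (auto simp: scaleC_prod_def cblinfun_scaleC scaleC_add_right)
qed


section \<open>Dimension and codimension with values in the extended naturals\<close>

text \<open>The library's \<open>dim\<close> is 0 on infinite-dimensional subspaces.\<close>

definition cedim :: "'a::complex_normed_vector set \<Rightarrow> enat"
  where "cedim V = (if \<exists>B. finite B \<and> cspan B = V then enat (cdim V) else \<infinity>)"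

text \<open>\<open>cbasis_mod M B\<close>: the cosets of the elements of \<open>B\<close> are distinct and form a basis of the
  quotient space by the subspace \<open>M\<close>. A linear combination of cosets vanishes in the quotient iff
  the same combination of representatives lies in \<open>M\<close>.\<close>

definition cbasis_mod :: "'a::complex_normed_vector set \<Rightarrow> 'a set \<Rightarrow> bool"
  where "cbasis_mod M B \<longleftrightarrow>
    (\<forall>F u. finite F \<and> F \<subseteq> B \<and> (\<Sum>v\<in>F. u v *\<^sub>C v) \<in> M \<longrightarrow> (\<forall>v\<in>F. u v = 0)) \<and>
    (\<forall>x. \<exists>y\<in>cspan B. x - y \<in> M)"

definition cecodim :: "'a::complex_normed_vector set \<Rightarrow> enat"
  where "cecodim M = (if \<exists>B. finite B \<and> cbasis_mod M B
    then enat (card (SOME B. finite B \<and> cbasis_mod M B)) else \<infinity>)"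

lemma cbasis_mod_card_le:
  assumes M: "csubspace M" and B: "finite B" "cbasis_mod M B" and B': "finite B'" "cbasis_mod M B'"
  shows "card B' \<le> card B"
proof -
  obtain p where p: "\<And>x. p x \<in> cspan B" "\<And>x. x - p x \<in> M"
    using B(2) unfolding cbasis_mod_def by metis
  have key: "\<forall>v\<in>B'. u v = 0" if "(\<Sum>v\<in>B'. u v *\<^sub>C p v) = 0" for u
  proof -
    have "(\<Sum>v\<in>B'. u v *\<^sub>C (v - p v)) \<in> M"
      by (intro complex_vector.subspace_sum[OF M] complex_vector.subspace_scale[OF M] p)
    then have "(\<Sum>v\<in>B'. u v *\<^sub>C v) \<in> M"
      using that by (simp add: complex_vector.scale_right_diff_distrib sum_subtractf)
    then show ?thesis using B' unfolding cbasis_mod_def by blast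
  qed
  have inj: "inj_on p B'"
  proof (rule inj_onI, rule ccontr)
    fix v w assume vw: "v \<in> B'" "w \<in> B'" "p v = p w" "v \<noteq> w"
    let ?u = "\<lambda>z. if z = v then 1 else if z = w then -1 else (0::complex)"
    have "(\<Sum>z\<in>B'. ?u z *\<^sub>C p z) = (\<Sum>z\<in>{v, w}. ?u z *\<^sub>C p z)"
      using vw B'(1) by (intro sum.mono_neutral_right) auto
    also have "\<dots> = 0" using vw by simp
    finally show False using key[of ?u] vw(1) by auto
  qed
  have "\<not> cdependent (p ` B')"
  proof
    assume "cdependent (p ` B')"
    then obtain u v where u: "(\<Sum>w\<in>p ` B'. u w *\<^sub>C w) = 0" "v \<in> p ` B'" "u v \<noteq> 0"
      using B'(1) by (auto simp: complex_vector.dependent_finite)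
    then show False using key[of "\<lambda>w. u (p w)"] by (auto simp: sum.reindex[OF inj])
  qed
  then have "card (p ` B') \<le> card B"
    using p(1) B(1) complex_vector.independent_span_bound by blast
  then show ?thesis by (simp add: card_image[OF inj])
qed

lemma cecodim_eq_card:
  assumes "csubspace M" "finite B" "cbasis_mod M B"
  shows "cecodim M = enat (card B)"
proof -
  let ?P = "\<lambda>B. finite B \<and> cbasis_mod M B"
  have "?P (SOME B. ?P B)" using assms by (intro someI[of ?P B]) simp
  then have "card (SOME B. ?P B) = card B"
    using assms cbasis_mod_card_le by (metis (no_types, lifting) le_antisym)
  then show ?thesis using assms by (auto simp: cecodim_def)
qed


section \<open>Left semi-Weyl operators\<close>

definition null_space :: "('a::complex_normed_vector \<Rightarrow>\<^sub>C\<^sub>L 'b::complex_normed_vector) \<Rightarrow> 'a set"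
  where "null_space T = {x. cblinfun_apply T x = 0}"

definition nullity :: "('a::complex_normed_vector \<Rightarrow>\<^sub>C\<^sub>L 'b::complex_normed_vector) \<Rightarrow> enat"
  where "nullity T = cedim (null_space T)"

definition deficiency :: "('a::complex_normed_vector \<Rightarrow>\<^sub>C\<^sub>L 'b::complex_normed_vector) \<Rightarrow> enat"
  where "deficiency T = cecodim (range (cblinfun_apply T))"

text \<open>Meaningful only if one of the two terms is finite.\<close>

definition ind :: "('a::complex_normed_vector \<Rightarrow>\<^sub>C\<^sub>L 'b::complex_normed_vector) \<Rightarrow> ereal"
  where "ind T = ereal_of_enat (nullity T) - ereal_of_enat (deficiency T)"

definition closed_complemented :: "'a::complex_normed_vector set \<Rightarrow> bool"
  where "closed_complemented M \<longleftrightarrow> csubspace M \<and> closed M \<and>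
    (\<exists>N. csubspace N \<and> closed N \<and> M \<inter> N = {0} \<and> {m + n | m n. m \<in> M \<and> n \<in> N} = UNIV)"

definition left_semi_Fredholm :: "('a::complex_normed_vector \<Rightarrow>\<^sub>C\<^sub>L 'a) set"
  where "left_semi_Fredholm =
    {T. closed_complemented (range (cblinfun_apply T)) \<and> nullity T < \<infinity>}"

definition left_semi_Weyl :: "('a::complex_normed_vector \<Rightarrow>\<^sub>C\<^sub>L 'a) set"
  where "left_semi_Weyl = {T \<in> left_semi_Fredholm. ind T \<le> 0}"

definition left_semi_Weyl_spectrum :: "('a::complex_normed_vector \<Rightarrow>\<^sub>C\<^sub>L 'a) \<Rightarrow> complex set"
  where "left_semi_Weyl_spectrum T = {l. T - l *\<^sub>C cid \<notin> left_semi_Weyl}"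


section \<open>The single valued extension property\<close>

text \<open>Vector-valued analyticity, as complex differentiability at every point of an open set.\<close>

definition vanalytic_on :: "(complex \<Rightarrow> 'a::complex_normed_vector) \<Rightarrow> complex set \<Rightarrow> bool"
  where "vanalytic_on f V \<longleftrightarrow> (\<forall>z\<in>V. \<exists>d. (f has_derivative (\<lambda>h. h *\<^sub>C d)) (at z))"

definition SVEP_at :: "('a::complex_normed_vector \<Rightarrow>\<^sub>C\<^sub>L 'a) \<Rightarrow> complex \<Rightarrow> bool"
  where "SVEP_at T l \<longleftrightarrow> (\<exists>r>0. \<forall>V f. open V \<and> V \<subseteq> ball l r \<and> vanalytic_on f V \<and>
    (\<forall>\<mu>\<in>V. cblinfun_apply (T - \<mu> *\<^sub>C cid) (f \<mu>) = 0) \<longrightarrow> (\<forall>\<mu>\<in>V. f \<mu> = 0))"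

definition SVEP_failure :: "('a::complex_normed_vector \<Rightarrow>\<^sub>C\<^sub>L 'a) \<Rightarrow> complex set"
  where "SVEP_failure T = {l. \<not> SVEP_at T l}"

end

theory Submission
  imports Defs
begin

text \<open>The two sides are compared one point \<open>\<lambda>\<close> at a time. Outside the set
\<open>(S(A) \<inter> S(B\<^sup>*)) \<union> S(A\<^sup>*)\<close>, which both sides contain, the claim is that \<open>M\<^sub>C - \<lambda>\<close> is left
semi-Weyl if and only if \<open>A - \<lambda>\<close> and \<open>B - \<lambda>\<close> are. A shift reduces this to \<open>\<lambda> = 0\<close>.

Being left semi-Fredholm means having a left inverse modulo operators of finite rank
(\<open>left_semi_Fredholm_iff_left_parametrix\<close>), and such a parametrix can be computed blockwise. From
parametrices of \<open>A\<close> and \<open>B\<close> one gets a triangular one of \<open>M\<^sub>C\<close>. Conversely the upper left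
block of a parametrix of \<open>M\<^sub>C\<close> serves \<open>A\<close>; its lower right block serves \<open>B\<close>, provided that \<open>A\<close>
also has finite deficiency. The index is additive in the strong form of
\<open>upper_triangular_nullity_deficiency\<close>: nullity and deficiency of \<open>M\<^sub>C\<close> fall short of those of
\<open>A\<close> and \<open>B\<close> together by the same number \<open>k\<close>, which is finite if \<open>B\<close> has finite nullity. So the index
of \<open>M\<^sub>C\<close> is nonpositive if those of \<open>A\<close> and \<open>B\<close> are.

For the converse, the single valued extension property controls the sign of the index. If \<open>T\<close> is left
semi-Fredholm and has the property at 0, then its nullity is at most its deficiency; if \<open>T\<^sup>*\<close> has it,
the reverse inequality holds. Hence \<open>A\<close>, whose dual has the property, is Fredholm with
nonnegative index, and \<open>B\<close> is left semi-Fredholm. Either \<open>A\<close> has the property, so that its index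
is 0 and \<open>B\<close> inherits the sign from \<open>M\<^sub>C\<close>; or \<open>B\<^sup>*\<close> has it, and two nonnegative indices
with nonpositive sum both vanish.

The link between the property and the index is \<open>SVEP_imp_nullity_bound\<close>. If \<open>T S\<close> differs from
the identity by an operator of rank at most \<open>m\<close>, every null vector \<open>b\<close> of \<open>T\<close> spreads to the analytic
family \<open>x(\<mu>) = (I - \<mu>S)\<^sup>-\<^sup>1 b\<close>, for which \<open>(T - \<mu>) x(\<mu>)\<close> involves only \<open>m\<close> scalar functions. With more
than \<open>m\<close> independent null vectors, elimination over holomorphic functions combines these families
into an analytic family of eigenvectors, and the property fails. It is applied to \<open>T\<close> and to \<open>T\<^sup>*\<close>; in
the second case the nullity of \<open>T\<^sup>*\<close> bounds the deficiency of \<open>T\<close>. Two classical theorems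
carry the analysis: the open mapping theorem makes generalized inverses bounded, and the
Hahn-Banach theorem supplies coordinate functionals and enough functionals vanishing on a closed
range.\<close>

section \<open>The open mapping and Hahn-Banach theorems\<close>


text \<open>The open mapping theorem for a closed linear relation: by Baire's theorem some set of points with a
preimage of norm at most \<open>n\<close> is dense in a ball, which gives approximate solutions with a linear norm
bound, and summing the successive corrections makes them exact. Stating it for relations spares
the passage to subspaces and quotients as Banach spaces of their own; the projection onto a
complement and the inverse on a range are relations of this kind.\<close>

lemma closed_relation_bounded_selection:
  fixes G :: "('a::banach \<times> 'b::banach) set"
  assumes sub: "subspace G" and clo: "closed G" and surj: "\<And>y. \<exists>x. (x, y) \<in> G"
  obtains K where "\<And>y. \<exists>x. (x, y) \<in> G \<and> norm x \<le> K * norm y"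
proof -
  define U where "U n = {y. \<exists>x. (x, y) \<in> G \<and> norm x \<le> real n}" for n
  have "Met_TC.mcomplete TYPE('b)"
    unfolding Met_TC.mcomplete_def by (auto simp: Cauchy_convergent_iff convergent_def)
  have "interior (\<Union>(range (\<lambda>n. closure (U n)))) = {}"
    if "\<And>n. interior (closure (U n)) = {}"
  proof -
    have "countable (range (\<lambda>n. closure (U n)))" by simp
    then show ?thesis
      using Met_TC.metric_Baire_category_alt[OF \<open>Met_TC.mcomplete TYPE('b)\<close>, of "range (\<lambda>n. closure (U n))"]
      by (simp add: image_iff that) (metis closed_closure that)
  qed
  moreover have "\<Union>(range (\<lambda>n. closure (U n))) = UNIV"
  proof -
    have "y \<in> (\<Union>n. closure (U n))" for y
    proof -
      obtain x where "(x, y) \<in> G" using surj by blast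
      moreover obtain n where "norm x \<le> real n" using real_arch_simple by blast
      ultimately have "y \<in> U n" by (auto simp: U_def)
      then show ?thesis using closure_subset by blast
    qed
    then show ?thesis by blast
  qed
  ultimately have "\<not> (\<forall>n. interior (closure (U n)) = {})" by auto
  then obtain n y0 where "y0 \<in> interior (closure (U n))"
    by blast
  then obtain e where e: "e > 0" "ball y0 e \<subseteq> closure (U n)"
    by (auto simp: mem_interior)
  have approx: "\<exists>x y'. (x, y') \<in> G \<and> norm x \<le> 2 * real n \<and> dist y' y < d"
    if y: "norm y < e" and d: "d > 0" for y d
  proof -
    have "y0 + y \<in> closure (U n)" "y0 \<in> closure (U n)"
      using e y by (auto simp: dist_norm)
    then obtain a b where ab: "a \<in> U n" "dist a (y0 + y) < d/2" "b \<in> U n" "dist b y0 < d/2"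
      using d unfolding closure_approachable by (meson half_gt_zero)
    then obtain p q where pq: "(p, a) \<in> G" "norm p \<le> n" "(q, b) \<in> G" "norm q \<le> n"
      by (auto simp: U_def)
    have "(p - q, a - b) \<in> G"
      using subspace_diff[OF sub pq(1) pq(3)] by simp
    moreover have "norm (p - q) \<le> 2 * real n"
      using norm_triangle_ineq4[of p q] pq by linarith
    moreover have "dist (a - b) y < d"
    proof -
      have "norm ((a - (y0 + y)) - (b - y0)) \<le> norm (a - (y0 + y)) + norm (b - y0)"
        by (rule norm_triangle_ineq4)
      moreover have "(a - (y0 + y)) - (b - y0) = a - b - y" by simp
      ultimately show ?thesis using ab by (simp add: dist_norm)
    qed
    ultimately show ?thesis by blast
  qed
  \<comment> \<open>Scaling \<open>y\<close> to norm \<open>e / 2\<close> turns the bound \<open>2 n\<close> into the factor \<open>4 n / e\<close>.\<close>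
  define c where "c = 4 * real n / e"
  have half: "\<exists>x y'. (x, y') \<in> G \<and> norm x \<le> c * norm y \<and> norm (y - y') \<le> norm y / 2" for y
  proof (cases "y = 0")
    case True
    then show ?thesis using subspace_0[OF sub] by (intro exI[of _ 0]) (auto simp: zero_prod_def)
  next
    case False
    define s where "s = e / (2 * norm y)"
    have s: "s > 0" using e False by (simp add: s_def)
    have "norm (s *\<^sub>R y) < e" using e False by (simp add: s_def)
    then obtain x y' where xy: "(x, y') \<in> G" "norm x \<le> 2 * real n" "dist y' (s *\<^sub>R y) < s * (norm y / 2)"
      using approx[of "s *\<^sub>R y" "s * (norm y / 2)"] s False by auto
    have "(inverse s *\<^sub>R x, inverse s *\<^sub>R y') \<in> G"
      using subspace_scale[OF sub xy(1), of "inverse s"] by simp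
    moreover have "norm (inverse s *\<^sub>R x) \<le> c * norm y"
    proof -
      have "norm (inverse s *\<^sub>R x) = inverse s * norm x" using s by simp
      also have "\<dots> \<le> inverse s * (2 * real n)"
        using s xy(2) by (intro mult_left_mono) auto
      also have "\<dots> = c * norm y" using e False by (simp add: s_def c_def field_simps)
      finally show ?thesis .
    qed
    moreover have "norm (y - inverse s *\<^sub>R y') \<le> norm y / 2"
    proof -
      have "y - inverse s *\<^sub>R y' = inverse s *\<^sub>R (s *\<^sub>R y - y')"
        using s by (simp add: scaleR_diff_right)
      then have "norm (y - inverse s *\<^sub>R y') = inverse s * norm (s *\<^sub>R y - y')"
        using s by simp
      also have "\<dots> \<le> inverse s * (s * (norm y / 2))"
        using s xy(3) by (intro mult_left_mono) (auto simp: dist_norm norm_minus_commute)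
      also have "\<dots> = norm y / 2" using s by simp
      finally show ?thesis .
    qed
    ultimately show ?thesis by blast
  qed
  then obtain g h where gh: "\<And>y. (g y, h y) \<in> G" "\<And>y. norm (g y) \<le> c * norm y"
      "\<And>y. norm (y - h y) \<le> norm y / 2"
    by metis
  have c0: "c \<ge> 0" using e by (simp add: c_def)
  have "\<exists>x. (x, y) \<in> G \<and> norm x \<le> (2 * c) * norm y" for y
  proof -
    \<comment> \<open>\<open>r k\<close> is the error left after \<open>k\<close> corrections; it is halved each time.\<close>
    define r where "r k = ((\<lambda>y. y - h y) ^^ k) y" for k
    have r0: "r 0 = y" and rS: "r (Suc k) = r k - h (r k)" for k
      by (simp_all add: r_def)
    have r_le: "norm (r k) \<le> norm y * (1/2) ^ k" for k
    proof (induction k)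
      case (Suc k)
      then show ?case using gh(3)[of "r k"] by (simp add: rS)
    qed (simp add: r0)
    have g_le: "norm (g (r k)) \<le> c * norm y * (1/2) ^ k" for k
      using gh(2)[of "r k"] mult_left_mono[OF r_le c0, of k] by (simp add: mult.assoc)
    have half_sums: "(\<lambda>k. c * norm y * (1/2) ^ k) sums (2 * c * norm y)"
      using sums_mult[OF geometric_sums[of "1/2 :: real"], of "c * norm y"] by (simp add: mult_ac)
    have sm: "summable (\<lambda>k. g (r k))"
      by (rule summable_comparison_test[OF _ sums_summable[OF half_sums]]) (use g_le in auto)
    define x where "x = (\<Sum>k. g (r k))"
    have "norm x \<le> (\<Sum>k. c * norm y * (1/2) ^ k)"
      unfolding x_def by (rule norm_suminf_le[OF g_le sums_summable[OF half_sums]])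
    then have nx: "norm x \<le> 2 * c * norm y" using sums_unique[OF half_sums] by simp
    have part: "((\<Sum>k<n. g (r k)), y - r n) \<in> G" for n
    proof (induction n)
      case 0
      then show ?case using subspace_0[OF sub] by (simp add: r0 zero_prod_def)
    next
      case (Suc n)
      from subspace_add[OF sub Suc gh(1)[of "r n"]] show ?case
        by (simp add: rS algebra_simps)
    qed
    have "(\<lambda>n. norm y * (1/2) ^ n) \<longlonglongrightarrow> norm y * 0"
      by (intro tendsto_intros LIMSEQ_realpow_zero) auto
    then have lim: "(\<lambda>n. norm y * (1/2) ^ n) \<longlonglongrightarrow> 0" by simp
    have "r \<longlonglongrightarrow> 0"
      by (rule Lim_null_comparison[OF always_eventually lim]) (rule allI, rule r_le)
    then have "(\<lambda>n. ((\<Sum>k<n. g (r k)), y - r n)) \<longlonglongrightarrow> (x, y - 0)"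
      unfolding x_def by (intro tendsto_intros summable_LIMSEQ[OF sm])
    then have "(x, y - 0) \<in> G"
      by (rule closed_sequentially[OF clo part])
    then show ?thesis using nx by (intro exI[of _ x]) simp
  qed
  then show thesis using that by blast
qed

text \<open>A bounded functional on a subspace is represented by its graph. The norm bound alone makes a
linear relation single-valued, so Zorn's lemma applies directly to subspaces of the product, and no
domains have to be carried along.\<close>

lemma Hahn_Banach_graph:
  fixes G0 :: "('a::real_normed_vector \<times> real) set"
  assumes sub: "subspace G0" and bd: "\<And>a b. (a, b) \<in> G0 \<Longrightarrow> \<bar>b\<bar> \<le> c * norm a" and c: "c \<ge> 0"
  obtains f where "bounded_linear f" "\<And>a b. (a, b) \<in> G0 \<Longrightarrow> f a = b"
proof -
  define \<A> where "\<A> = {G. G0 \<subseteq> G \<and> subspace G \<and> (\<forall>(a, b)\<in>G. \<bar>b\<bar> \<le> c * norm a)}"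
  have "\<exists>M\<in>\<A>. \<forall>X\<in>\<A>. M \<subseteq> X \<longrightarrow> X = M"
  proof (rule subset_Zorn_nonempty)
    have "\<forall>(a, b)\<in>G0. \<bar>b\<bar> \<le> c * norm a" using bd by blast
    then have "G0 \<in> \<A>" using sub unfolding \<A>_def by simp
    then show "\<A> \<noteq> {}" by blast
  next
    fix \<C> assume C: "\<C> \<noteq> {}" "subset.chain \<A> \<C>"
    have two: "\<exists>G\<in>\<C>. p \<in> G \<and> q \<in> G" if pq: "p \<in> \<Union>\<C>" "q \<in> \<Union>\<C>" for p q
    proof -
      obtain G H where "G \<in> \<C>" "p \<in> G" "H \<in> \<C>" "q \<in> H" using pq by blast
      moreover have "G \<subseteq> H \<or> H \<subseteq> G"
        using C(2) \<open>G \<in> \<C>\<close> \<open>H \<in> \<C>\<close> unfolding subset_chain_def by blast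
      ultimately show ?thesis by blast
    qed
    have inA: "G \<in> \<A>" if "G \<in> \<C>" for G
      using C(2) that unfolding subset.chain_def by blast
    have "subspace (\<Union>\<C>)"
    proof (rule subspaceI)
      show "0 \<in> \<Union>\<C>" using C(1) inA by (auto simp: \<A>_def subspace_0)
      show "p + q \<in> \<Union>\<C>" if pq: "p \<in> \<Union>\<C>" "q \<in> \<Union>\<C>" for p q
        using two[OF pq] inA by (auto simp: \<A>_def intro: subspace_add)
      show "r *\<^sub>R p \<in> \<Union>\<C>" if "p \<in> \<Union>\<C>" for r p
        using that inA by (auto simp: \<A>_def intro: subspace_scale)
    qed
    then show "\<Union>\<C> \<in> \<A>" using C(1) inA by (fastforce simp: \<A>_def)
  qed
  then obtain G where GA: "G \<in> \<A>" and Gmax: "\<forall>X\<in>\<A>. G \<subseteq> X \<longrightarrow> X = G"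
    by blast
  have G: "G0 \<subseteq> G" "subspace G" "\<And>a b. (a, b) \<in> G \<Longrightarrow> \<bar>b\<bar> \<le> c * norm a"
    using GA by (auto simp: \<A>_def)
  have max: "H = G" if "G \<subseteq> H" "subspace H" "\<And>a b. (a, b) \<in> H \<Longrightarrow> \<bar>b\<bar> \<le> c * norm a" for H
  proof -
    have "H \<in> \<A>" using that G(1) by (auto simp: \<A>_def)
    then show ?thesis using Gmax that(1) by blast
  qed
  have uniq: "b = b'" if "(a, b) \<in> G" "(a, b') \<in> G" for a b b'
    using G(3)[of 0 "b - b'"] subspace_diff[OF G(2) that] by simp
  have total: "\<exists>b. (x, b) \<in> G" for x
  proof -
    \<comment> \<open>An extension to \<open>x\<close> must take a value \<open>\<xi>\<close> above every element of \<open>L\<close> and below all the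
      corresponding upper bounds; the supremum of \<open>L\<close> is one.\<close>
    define L where "L = {- b - c * norm (a + x) | a b. (a, b) \<in> G}"
    have below: "- b - c * norm (a + x) \<le> - b' + c * norm (a' + x)"
      if ab: "(a, b) \<in> G" "(a', b') \<in> G" for a b a' b'
    proof -
      have "\<bar>b' - b\<bar> \<le> c * norm (a' - a)"
        using G(3) subspace_diff[OF G(2) ab(2) ab(1)] by simp
      also have "\<dots> \<le> c * (norm (a' + x) + norm (a + x))"
        using norm_triangle_ineq4[of "a' + x" "a + x"] c by (intro mult_left_mono) auto
      finally show ?thesis by (simp add: algebra_simps)
    qed
    have "(0, 0) \<in> G" using subspace_0[OF G(2)] by (simp add: zero_prod_def)
    then have Lne: "L \<noteq> {}" by (auto simp: L_def)
    have Lbd: "bdd_above L"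
      using below \<open>(0,0) \<in> G\<close> unfolding L_def by (auto intro!: bdd_aboveI)
    define \<xi> where "\<xi> = Sup L"
    have xi: "\<bar>b + \<xi>\<bar> \<le> c * norm (a + x)" if ab: "(a, b) \<in> G" for a b
    proof -
      have "- b - c * norm (a + x) \<le> \<xi>"
        unfolding \<xi>_def by (rule cSup_upper[OF _ Lbd]) (use ab in \<open>auto simp: L_def\<close>)
      moreover have "\<xi> \<le> - b + c * norm (a + x)"
        unfolding \<xi>_def by (rule cSup_least[OF Lne]) (use ab below in \<open>auto simp: L_def\<close>)
      ultimately show ?thesis by linarith
    qed
    define H where "H = {p + q | p q. p \<in> G \<and> q \<in> span {(x, \<xi>)}}"
    have "subspace H" unfolding H_def by (intro subspace_sums G subspace_span)
    moreover have "G \<subseteq> H"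
      unfolding H_def using span_zero by (metis (mono_tags, lifting) add.right_neutral mem_Collect_eq subsetI)
    moreover have "\<bar>b\<bar> \<le> c * norm a" if "(a, b) \<in> H" for a b
    proof -
      obtain a' b' t where t: "(a', b') \<in> G" "a = a' + t *\<^sub>R x" "b = b' + t * \<xi>"
        using \<open>(a, b) \<in> H\<close> by (auto simp: H_def span_singleton)
      show ?thesis
      proof (cases "t = 0")
        case True
        then show ?thesis using t G(3) by simp
      next
        case False
        have "\<bar>inverse t * b' + \<xi>\<bar> \<le> c * norm (inverse t *\<^sub>R a' + x)"
          using xi subspace_scale[OF G(2) t(1), of "inverse t"] by simp
        then have "\<bar>t\<bar> * \<bar>inverse t * b' + \<xi>\<bar> \<le> \<bar>t\<bar> * (c * norm (inverse t *\<^sub>R a' + x))"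
          by (rule mult_left_mono) simp
        moreover have "\<bar>t\<bar> * \<bar>inverse t * b' + \<xi>\<bar> = \<bar>b\<bar>"
          using False unfolding abs_mult[symmetric] t by (simp add: algebra_simps)
        moreover have "\<bar>t\<bar> * (c * norm (inverse t *\<^sub>R a' + x)) = c * norm a"
        proof -
          have "\<bar>t\<bar> * norm (inverse t *\<^sub>R a' + x) = norm (t *\<^sub>R (inverse t *\<^sub>R a' + x))" by simp
          also have "t *\<^sub>R (inverse t *\<^sub>R a' + x) = a" using False t by (simp add: scaleR_add_right)
          finally show ?thesis by (simp add: algebra_simps)
        qed
        ultimately show ?thesis by simp
      qed
    qed
    ultimately have "H = G" using max by blast
    moreover have "(x, \<xi>) \<in> H"
      unfolding H_def using subspace_0[OF G(2)] span_base[of "(x, \<xi>)" "{(x, \<xi>)}"]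
      by (metis (mono_tags, lifting) add.left_neutral mem_Collect_eq singletonI)
    ultimately show ?thesis by blast
  qed
  define f where "f x = (SOME b. (x, b) \<in> G)" for x
  have f: "(x, f x) \<in> G" for x
    unfolding f_def using total by (rule someI_ex)
  have "bounded_linear f"
  proof (rule bounded_linear_intro[where K = c])
    show "f (x + y) = f x + f y" for x y
      using uniq[OF f] subspace_add[OF G(2) f f, of x y] by simp
    show "f (r *\<^sub>R x) = r *\<^sub>R f x" for r x
      using uniq[OF f] subspace_scale[OF G(2) f, of r x] by simp
    show "norm (f x) \<le> norm x * c" for x
      using G(3)[OF f, of x] by (simp add: mult.commute)
  qed
  moreover have "f a = b" if "(a, b) \<in> G0" for a b
    using uniq[OF f] that G(1) by blast
  ultimately show thesis using that by blast
qed

lemma csubspace_imp_subspace: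
  assumes "csubspace M"
  shows "subspace (M :: 'a::complex_normed_vector set)"
  using assms unfolding subspace_def complex_vector.subspace_def by (simp add: scaleR_scaleC)

text \<open>The real functional that vanishes on \<open>M\<close> and is 1 at \<open>x\<close> is bounded because \<open>x\<close> has
positive distance from \<open>M\<close>. If \<open>f\<close> extends it, then \<open>f(y) - \<i> f(\<i> y)\<close> is complex-linear.\<close>

lemma separating_functional:
  fixes M :: "'a::complex_normed_vector set"
  assumes M: "csubspace M" "closed M" and x: "x \<notin> M"
  shows "\<exists>\<phi> :: 'a cdual. (\<forall>m\<in>M. cblinfun_apply \<phi> m = 0) \<and> cblinfun_apply \<phi> x = 1"
proof -
  define d where "d = infdist x M"
  have M0: "0 \<in> M" using complex_vector.subspace_0[OF M(1)] .
  have d: "d > 0"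
    unfolding d_def using M(2) M0 x by (metis empty_iff in_closed_iff_infdist_zero infdist_nonneg less_eq_real_def)
  have rM: "subspace M" using M(1) by (rule csubspace_imp_subspace)
  define G0 where "G0 = {p + q | p q. p \<in> M \<times> {0::real} \<and> q \<in> span {(x, 1)}}"
  have G0_iff: "(a, b) \<in> G0 \<longleftrightarrow> a - b *\<^sub>R x \<in> M" for a b
  proof
    assume "(a, b) \<in> G0" then show "a - b *\<^sub>R x \<in> M"
      by (auto simp: G0_def span_singleton)
  next
    assume "a - b *\<^sub>R x \<in> M"
    then have "(a - b *\<^sub>R x, 0) \<in> M \<times> {0::real}" "b *\<^sub>R (x, 1::real) \<in> span {(x, 1)}"
      by (auto simp: span_singleton)
    moreover have "(a, b) = (a - b *\<^sub>R x, 0) + b *\<^sub>R (x, 1::real)" by simp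
    ultimately show "(a, b) \<in> G0" unfolding G0_def by blast
  qed
  have "subspace G0"
    unfolding G0_def by (intro subspace_sums subspace_Times rM subspace_span subspace_single_0)
  moreover have "\<bar>b\<bar> \<le> inverse d * norm a" if "(a, b) \<in> G0" for a b
  proof (cases "b = 0")
    case False
    have "- (inverse b *\<^sub>R (a - b *\<^sub>R x)) \<in> M"
      using that unfolding G0_iff by (intro subspace_neg subspace_scale rM)
    then have "x - inverse b *\<^sub>R a \<in> M"
      using False by (simp add: scaleR_diff_right)
    then have "d \<le> dist x (x - inverse b *\<^sub>R a)" unfolding d_def by (rule infdist_le)
    also have "\<dots> = inverse \<bar>b\<bar> * norm a" by (simp add: dist_norm)
    finally show ?thesis using d False by (simp add: field_simps)
  qed (use d in simp)
  ultimately obtain f where f: "bounded_linear f" "\<And>a b. (a, b) \<in> G0 \<Longrightarrow> f a = b"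
    using Hahn_Banach_graph[of G0 "inverse d"] d by (metis inverse_nonnegative_iff_nonnegative less_eq_real_def)
  interpret f: bounded_linear f by fact
  have fM: "f m = 0" if "m \<in> M" for m using that by (intro f(2)) (simp add: G0_iff)
  have fx: "f x = 1" by (rule f(2)) (use M0 in \<open>simp add: G0_iff\<close>)
  define g where "g y = complex_of_real (f y) - \<i> * complex_of_real (f (\<i> *\<^sub>C y))" for y
  have g_bl: "bounded_linear g"
    unfolding g_def
    by (intro bounded_linear_sub bounded_linear_const_mult bounded_linear_compose[OF bounded_linear_of_real]
        f bounded_linear_compose[OF f(1)] bounded_linear_scaleC)
  have g_sc: "g (c *\<^sub>C y) = c *\<^sub>C g y" for c y
  proof -
    have split: "f (c *\<^sub>C z) = Re c * f z + Im c * f (\<i> *\<^sub>C z)" for c z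
    proof -
      have "c *\<^sub>C z = Re c *\<^sub>R z + Im c *\<^sub>R (\<i> *\<^sub>C z)"
        by (simp add: scaleR_scaleC scaleC_scaleC flip: scaleC_add_left)
           (simp add: complex_eq mult.commute)
      then show ?thesis by (simp add: f.add f.scale)
    qed
    have fi: "f (\<i> *\<^sub>C c *\<^sub>C y) = - Im c * f y + Re c * f (\<i> *\<^sub>C y)"
      unfolding scaleC_scaleC using split[of "\<i> * c" y] by simp
    show ?thesis
      unfolding g_def scaleC_complex_def fi split[of c y]
      by (rule complex_eqI) simp_all
  qed
  have gM: "g m = 0" if "m \<in> M" for m
    using fM[OF that] fM[OF complex_vector.subspace_scale[OF M(1) that, of \<i>]] by (simp add: g_def)
  have gx: "g x \<noteq> 0" using fx by (simp add: g_def complex_eq_iff)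
  define \<phi> where "\<phi> = inverse (g x) *\<^sub>C mk_cblinfun g"
  have "cblinfun_apply \<phi> y = g y / g x" for y
    by (simp add: \<phi>_def cblinfun_apply_simps mk_cblinfun_apply[OF g_bl g_sc] scaleC_complex_def divide_inverse mult.commute)
  then show ?thesis using gM gx by (intro exI[of _ \<phi>]) simp
qed


section \<open>Closed subspaces and operators of finite rank\<close>

lemma cblinfun_linear:
  "cblinfun_apply T (x + y) = cblinfun_apply T x + cblinfun_apply T y"
  "cblinfun_apply T (x - y) = cblinfun_apply T x - cblinfun_apply T y"
  "cblinfun_apply T (- x) = - cblinfun_apply T x"
  "cblinfun_apply T 0 = 0"
  "cblinfun_apply T (sum f I) = (\<Sum>i\<in>I. cblinfun_apply T (f i))"
  by (simp_all add: bounded_linear.linear[OF bounded_linear_cblinfun] linear_add linear_diff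
      linear_neg linear_0 linear_sum)

lemma continuous_on_cblinfun [continuous_intros]:
  "continuous_on A f \<Longrightarrow> continuous_on A (\<lambda>x. cblinfun_apply T (f x))"
  using bounded_linear.continuous_on[OF bounded_linear_cblinfun] .

lemma csubspace_preimage:
  assumes "csubspace M" shows "csubspace {x. cblinfun_apply T x \<in> M}"
  using assms unfolding complex_vector.subspace_def by (auto simp: cblinfun_linear cblinfun_scaleC)

lemma closed_preimage:
  assumes "closed M" shows "closed {x. cblinfun_apply T x \<in> M}"
  using closed_vimage[OF assms, of "cblinfun_apply T"]
  by (simp add: vimage_def linear_continuous_on[OF bounded_linear_cblinfun])

lemma csubspace_image:
  assumes "csubspace M" shows "csubspace (cblinfun_apply T ` M)"
  unfolding complex_vector.subspace_def
proof (intro conjI ballI allI)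
  show "0 \<in> cblinfun_apply T ` M"
    using complex_vector.subspace_0[OF assms] by (metis cblinfun_linear(4) image_eqI)
  show "x + y \<in> cblinfun_apply T ` M" if "x \<in> cblinfun_apply T ` M" "y \<in> cblinfun_apply T ` M" for x y
    using that complex_vector.subspace_add[OF assms] by (auto simp flip: cblinfun_linear)
  show "c *\<^sub>C x \<in> cblinfun_apply T ` M" if "x \<in> cblinfun_apply T ` M" for c x
    using that complex_vector.subspace_scale[OF assms] by (auto simp flip: cblinfun_scaleC)
qed

lemma csubspace_range: "csubspace (range (cblinfun_apply T))"
  by (rule csubspace_image) (rule complex_vector.subspace_UNIV)

lemma csubspace_null_space: "csubspace (null_space T)"
  using csubspace_preimage[OF complex_vector.subspace_single_0, of T] by (simp add: null_space_def)

definition ccompose :: "('b::complex_normed_vector \<Rightarrow>\<^sub>C\<^sub>L 'c::complex_normed_vector)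
    \<Rightarrow> ('a::complex_normed_vector \<Rightarrow>\<^sub>C\<^sub>L 'b) \<Rightarrow> ('a \<Rightarrow>\<^sub>C\<^sub>L 'c)"
  where "ccompose S T = mk_cblinfun (\<lambda>x. cblinfun_apply S (cblinfun_apply T x))"

lemma ccompose_apply: "cblinfun_apply (ccompose S T) x = cblinfun_apply S (cblinfun_apply T x)"
  unfolding ccompose_def by (rule mk_cblinfun_apply)
    (auto intro: bounded_linear_compose[OF bounded_linear_cblinfun bounded_linear_cblinfun]
      simp: cblinfun_scaleC)

abbreviation subspace_sum :: "'a::complex_normed_vector set \<Rightarrow> 'a set \<Rightarrow> 'a set"
  where "subspace_sum M N \<equiv> {m + n | m n. m \<in> M \<and> n \<in> N}"

lemma subspace_sumI: "m \<in> M \<Longrightarrow> n \<in> N \<Longrightarrow> x = m + n \<Longrightarrow> x \<in> subspace_sum M N"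
  by blast

lemma subspace_sum_assoc:
  "subspace_sum (subspace_sum L M) N = subspace_sum L (subspace_sum M N)"
proof (intro subset_antisym subsetI)
  fix x assume "x \<in> subspace_sum (subspace_sum L M) N"
  then obtain l m n where "l \<in> L" "m \<in> M" "n \<in> N" "x = (l + m) + n" by blast
  then show "x \<in> subspace_sum L (subspace_sum M N)"
    by (intro subspace_sumI[of l _ "m + n"] subspace_sumI[of m _ n] refl) (auto simp: add.assoc)
next
  fix x assume "x \<in> subspace_sum L (subspace_sum M N)"
  then obtain l m n where "l \<in> L" "m \<in> M" "n \<in> N" "x = l + (m + n)" by blast
  then show "x \<in> subspace_sum (subspace_sum L M) N"
    by (intro subspace_sumI[of "l + m" _ n] subspace_sumI[of l _ m] refl) (auto simp: add.assoc)
qed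

text \<open>If \<open>\<phi>\<close> vanishes on \<open>M\<close> and \<open>\<phi>(x) = 1\<close>, then \<open>y\<close> lies in the sum exactly when
\<open>y - \<phi>(y) x\<close> lies in \<open>M\<close>, which is a closed condition.\<close>

lemma closed_subspace_sum_singleton:
  assumes M: "csubspace M" "closed M"
  shows "closed (subspace_sum M (cspan {x}))"
proof (cases "x \<in> M")
  case True
  then have "cspan {x} \<subseteq> M" by (intro complex_vector.span_minimal M) auto
  then have "subspace_sum M (cspan {x}) \<subseteq> M"
    using complex_vector.subspace_add[OF M(1)] by blast
  moreover have "m \<in> subspace_sum M (cspan {x})" if "m \<in> M" for m
    using that complex_vector.span_zero by (rule subspace_sumI) simp
  ultimately have "subspace_sum M (cspan {x}) = M" by blast
  then show ?thesis using M by simp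
next
  case False
  obtain \<phi> :: "'a cdual" where \<phi>: "\<forall>m\<in>M. cblinfun_apply \<phi> m = 0" "cblinfun_apply \<phi> x = 1"
    using separating_functional[OF M False] by blast
  have "y \<in> subspace_sum M (cspan {x}) \<longleftrightarrow> y - cblinfun_apply \<phi> y *\<^sub>C x \<in> M" for y
  proof
    assume "y \<in> subspace_sum M (cspan {x})"
    then obtain m c where "m \<in> M" "y = m + c *\<^sub>C x" by (auto simp: complex_vector.span_singleton)
    then show "y - cblinfun_apply \<phi> y *\<^sub>C x \<in> M"
      using \<phi> by (simp add: cblinfun_linear cblinfun_scaleC scaleC_complex_def)
  next
    assume "y - cblinfun_apply \<phi> y *\<^sub>C x \<in> M"
    moreover have "cblinfun_apply \<phi> y *\<^sub>C x \<in> cspan {x}" by (auto simp: complex_vector.span_singleton)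
    moreover have "y = (y - cblinfun_apply \<phi> y *\<^sub>C x) + cblinfun_apply \<phi> y *\<^sub>C x" by simp
    ultimately show "y \<in> subspace_sum M (cspan {x})" by blast
  qed
  then have eq: "subspace_sum M (cspan {x}) = (\<lambda>y. y - cblinfun_apply \<phi> y *\<^sub>C x) -` M"
    by blast
  have "bounded_linear (\<lambda>c::complex. c *\<^sub>C x)"
    by (rule bounded_linear_intro[where K = "norm x"])
      (simp_all add: scaleC_add_left scaleR_scaleC scaleC_scaleC norm_scaleC scaleC_complex_def)
  then have "continuous_on UNIV (\<lambda>y. cblinfun_apply \<phi> y *\<^sub>C x)"
    by (rule bounded_linear.continuous_on) (rule continuous_on_cblinfun[OF continuous_on_id])
  then show ?thesis
    unfolding eq by (intro closed_vimage M(2) continuous_on_diff continuous_on_id)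
qed

lemma span_insert_sum: "subspace_sum (cspan B) (cspan {x}) = cspan (insert x B)"
  using complex_vector.span_Un[of B "{x}"] by simp

lemma closed_cspan_finite:
  fixes B :: "'a::complex_normed_vector set"
  shows "finite B \<Longrightarrow> closed (cspan B)"
proof (induction B rule: finite_induct)
  case (insert x B)
  then show ?case
    using closed_subspace_sum_singleton[of "cspan B" x]
    by (simp add: span_insert_sum complex_vector.subspace_span)
qed simp

lemma biorthogonal_functionals:
  fixes B :: "'a::complex_normed_vector set"
  assumes B: "finite B" "\<not> cdependent B"
  shows "\<exists>\<phi> :: 'a \<Rightarrow> 'a cdual. \<forall>v\<in>B. \<forall>w\<in>B. cblinfun_apply (\<phi> v) w = (if v = w then 1 else 0)"
proof -
  have "\<exists>f :: 'a cdual. \<forall>w\<in>B. cblinfun_apply f w = (if v = w then 1 else 0)" if v: "v \<in> B" for v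
  proof -
    have "v \<notin> cspan (B - {v})" using B(2) v unfolding complex_vector.dependent_def by blast
    moreover have "closed (cspan (B - {v}))" using B(1) by (intro closed_cspan_finite) simp
    ultimately obtain f :: "'a cdual"
      where f: "\<forall>m\<in>cspan (B - {v}). cblinfun_apply f m = 0" "cblinfun_apply f v = 1"
      using separating_functional[OF complex_vector.subspace_span] by blast
    then have "cblinfun_apply f w = (if v = w then 1 else 0)" if "w \<in> B" for w
      using that f by (auto intro: complex_vector.span_base)
    then show ?thesis by blast
  qed
  then show ?thesis by metis
qed

text \<open>The coordinates of \<open>Q x\<close> depend continuously on \<open>x\<close>, since they are read off by functionals
biorthogonal to \<open>B\<close>.\<close>

lemma finite_rank_expansion:
  fixes Q :: "'a::complex_normed_vector \<Rightarrow>\<^sub>C\<^sub>L 'b::complex_normed_vector"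
  assumes B: "finite B" "\<not> cdependent B" and Q: "\<And>x. cblinfun_apply Q x \<in> cspan B"
  shows "\<exists>\<psi> :: 'b \<Rightarrow> 'a cdual. \<forall>x. cblinfun_apply Q x = (\<Sum>b\<in>B. cblinfun_apply (\<psi> b) x *\<^sub>C b)"
proof -
  obtain \<phi> :: "'b \<Rightarrow> 'b cdual" where \<phi>:
    "\<forall>v\<in>B. \<forall>w\<in>B. cblinfun_apply (\<phi> v) w = (if v = w then 1 else 0)"
    using biorthogonal_functionals[OF B] by blast
  have "cblinfun_apply Q x = (\<Sum>b\<in>B. cblinfun_apply (ccompose (\<phi> b) Q) x *\<^sub>C b)" for x
  proof -
    obtain u where u: "cblinfun_apply Q x = (\<Sum>b\<in>B. u b *\<^sub>C b)"
      using Q[of x] complex_vector.span_finite[OF B(1)] by auto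
    have "cblinfun_apply (\<phi> b) (cblinfun_apply Q x) = u b" if "b \<in> B" for b
      using that B(1) unfolding u
      by (simp add: cblinfun_linear cblinfun_scaleC \<phi> scaleC_complex_def if_distrib sum.delta cong: if_cong)
    then show ?thesis by (subst u) (rule sum.cong, simp_all add: ccompose_apply)
  qed
  then show ?thesis by (intro exI[of _ "\<lambda>b. ccompose (\<phi> b) Q"] allI)
qed

lemma finite_dimensional_subspace_basis:
  assumes V: "csubspace V" "V \<subseteq> cspan K" "finite K"
  obtains B where "finite B" "\<not> cdependent B" "cspan B = V"
proof -
  obtain B where B: "B \<subseteq> V" "\<not> cdependent B" "V \<subseteq> cspan B"
    using complex_vector.maximal_independent_subset by blast
  have "finite B"
    using complex_vector.independent_span_bound[OF V(3) B(2)] B(1) V(2) by blast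
  moreover have "cspan B = V"
    using B complex_vector.span_minimal[OF B(1) V(1)] by blast
  ultimately show thesis using B that by blast
qed

text \<open>Only the component \<open>x'\<close> of \<open>x\<close> in the complement \<open>N\<close> matters. If it is nonzero, a functional with value 1
at \<open>x'\<close> splits it off from \<open>N\<close>, and its kernel in \<open>N\<close> is the new complement.\<close>

lemma closed_complemented_add_vector:
  assumes M: "closed_complemented M"
  shows "closed_complemented (subspace_sum M (cspan {x}))"
proof -
  from M obtain N where N: "csubspace M" "closed M" "csubspace N" "closed N" "M \<inter> N = {0}"
      "subspace_sum M N = UNIV"
    unfolding closed_complemented_def by blast
  obtain m0 x' where x: "x = m0 + x'" "m0 \<in> M" "x' \<in> N" using N(6) by blast
  have sum_eq: "subspace_sum M (cspan {x}) = subspace_sum M (cspan {x'})"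
  proof -
    have "m + c *\<^sub>C x \<in> subspace_sum M (cspan {x'})" if "m \<in> M" for m c
    proof -
      have "m + c *\<^sub>C x = (m + c *\<^sub>C m0) + c *\<^sub>C x'" using x by (simp add: scaleC_add_right)
      moreover have "m + c *\<^sub>C m0 \<in> M"
        using that x N(1) by (simp add: complex_vector.subspace_add complex_vector.subspace_scale)
      moreover have "c *\<^sub>C x' \<in> cspan {x'}" by (auto simp: complex_vector.span_singleton)
      ultimately show ?thesis by blast
    qed
    moreover have "m + c *\<^sub>C x' \<in> subspace_sum M (cspan {x})" if "m \<in> M" for m c
    proof -
      have "m + c *\<^sub>C x' = (m - c *\<^sub>C m0) + c *\<^sub>C x" using x by (simp add: scaleC_add_right)
      moreover have "m - c *\<^sub>C m0 \<in> M"
        using that x N(1) by (simp add: complex_vector.subspace_diff complex_vector.subspace_scale)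
      moreover have "c *\<^sub>C x \<in> cspan {x}" by (auto simp: complex_vector.span_singleton)
      ultimately show ?thesis by blast
    qed
    ultimately show ?thesis by (auto simp: complex_vector.span_singleton)
  qed
  show ?thesis
  proof (cases "x' = 0")
    case True
    then have "subspace_sum M (cspan {x'}) = M" by simp
    then show ?thesis using M sum_eq by simp
  next
    case False
    then have "x' \<notin> {0}" by simp
    then obtain f :: "'a cdual" where f: "cblinfun_apply f x' = 1"
      using separating_functional[OF complex_vector.subspace_single_0 closed_singleton] by blast
    define N' where "N' = N \<inter> {y. cblinfun_apply f y \<in> {0}}"
    have "csubspace N'" "closed N'"
      unfolding N'_def
      by (intro complex_vector.subspace_inter N csubspace_preimage complex_vector.subspace_single_0 closed_Int closed_preimage closed_singleton)+
    moreover have "subspace_sum M (cspan {x'}) \<inter> N' = {0}"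
    proof -
      have "y = 0" if y0: "y \<in> subspace_sum M (cspan {x'})" "y \<in> N'" for y
      proof -
        obtain m c where y: "m \<in> M" "y = m + c *\<^sub>C x'" using y0(1) by (auto simp: complex_vector.span_singleton)
        have "y - c *\<^sub>C x' \<in> N"
          using that x N(3) by (simp add: N'_def complex_vector.subspace_diff complex_vector.subspace_scale)
        then have "m = 0" using y N(5) by auto
        then have "cblinfun_apply f y = c" using y f by (simp add: cblinfun_linear cblinfun_scaleC scaleC_complex_def)
        then show ?thesis using that y \<open>m = 0\<close> by (simp add: N'_def)
      qed
      moreover have "0 \<in> subspace_sum M (cspan {x'})"
        using complex_vector.subspace_0[OF N(1)] complex_vector.span_zero by (rule subspace_sumI) simp
      moreover have "0 \<in> N'" using complex_vector.subspace_0[OF \<open>csubspace N'\<close>] .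
      ultimately show ?thesis by blast
    qed
    moreover have "subspace_sum (subspace_sum M (cspan {x'})) N' = UNIV"
    proof -
      have "y \<in> subspace_sum (subspace_sum M (cspan {x'})) N'" for y
      proof -
        obtain m n where y: "y = m + n" "m \<in> M" "n \<in> N" using N(6) by blast
        define c where "c = cblinfun_apply f n"
        have "n - c *\<^sub>C x' \<in> N'"
          using y x N(3) f by (simp add: N'_def complex_vector.subspace_diff complex_vector.subspace_scale
              c_def cblinfun_linear cblinfun_scaleC scaleC_complex_def)
        moreover have "m + c *\<^sub>C x' \<in> subspace_sum M (cspan {x'})"
          using y by (auto simp: complex_vector.span_singleton)
        moreover have "y = (m + c *\<^sub>C x') + (n - c *\<^sub>C x')" using y by simp
        ultimately show ?thesis by blast
      qed
      then show ?thesis by blast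
    qed
    moreover have "csubspace (subspace_sum M (cspan {x'}))"
      by (intro complex_vector.subspace_sums N complex_vector.subspace_span)
    moreover have "closed (subspace_sum M (cspan {x'}))"
      by (intro closed_subspace_sum_singleton N)
    ultimately show ?thesis unfolding sum_eq closed_complemented_def by blast
  qed
qed

lemma closed_complemented_add_span:
  assumes "finite B" "closed_complemented M"
  shows "closed_complemented (subspace_sum M (cspan B))"
  using assms
proof (induction B rule: finite_induct)
  case empty
  then show ?case by simp
next
  case (insert x B)
  have "subspace_sum (subspace_sum M (cspan B)) (cspan {x}) = subspace_sum M (cspan (insert x B))"
    unfolding span_insert_sum[of B x, symmetric] by (rule subspace_sum_assoc)
  then show ?case
    using closed_complemented_add_vector[OF insert.IH[OF insert.prems], of x] by (simp only:)
qed

section \<open>Left semi-Fredholm operators and left parametrices\<close>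

lemma nullity_finite_iff: "nullity T < \<infinity> \<longleftrightarrow> (\<exists>B. finite B \<and> cspan B = null_space T)"
  by (simp add: nullity_def cedim_def)

text \<open>On a closed complement \<open>X\<close> of the null space, \<open>T\<close> is injective, and \<open>S y\<close> is the point of \<open>X\<close> that
\<open>T\<close> sends to the range component of \<open>y\<close>. The pairs \<open>(S y, y)\<close> form a closed relation, so that \<open>S\<close> is
bounded by the open mapping theorem.\<close>

lemma generalized_inverse:
  fixes T :: "'a::cbanach \<Rightarrow>\<^sub>C\<^sub>L 'b::cbanach"
  assumes fin: "nullity T < \<infinity>"
    and Z: "csubspace Z" "closed Z" "range (cblinfun_apply T) \<inter> Z = {0}"
      "subspace_sum (range (cblinfun_apply T)) Z = UNIV"
  shows "\<exists>S :: 'b \<Rightarrow>\<^sub>C\<^sub>L 'a. (\<forall>x. x - cblinfun_apply S (cblinfun_apply T x) \<in> null_space T)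
    \<and> (\<forall>y. y - cblinfun_apply T (cblinfun_apply S y) \<in> Z)"
proof -
  obtain K where K: "finite K" "cspan K = null_space T"
    using fin unfolding nullity_finite_iff by blast
  obtain B where B: "finite B" "\<not> cdependent B" "cspan B = null_space T"
    using finite_dimensional_subspace_basis[OF csubspace_null_space, of T K] K by blast
  obtain \<phi> :: "'a \<Rightarrow> 'a cdual" where \<phi>:
    "\<forall>v\<in>B. \<forall>w\<in>B. cblinfun_apply (\<phi> v) w = (if v = w then 1 else 0)"
    using biorthogonal_functionals[OF B(1,2)] by blast
  define X where "X = (\<Inter>v\<in>B. {x. cblinfun_apply (\<phi> v) x \<in> {0}})"
  have X: "csubspace X" "closed X"
    unfolding X_def
    by (intro complex_vector.subspace_Inter ballI, elim imageE, simp only:)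
      (intro csubspace_preimage closed_INT ballI closed_preimage closed_singleton complex_vector.subspace_single_0)+
  define P where "P x = (\<Sum>v\<in>B. cblinfun_apply (\<phi> v) x *\<^sub>C v)" for x
  have P_in: "P x \<in> null_space T" for x
    unfolding P_def B(3)[symmetric]
    by (intro complex_vector.span_sum complex_vector.span_scale complex_vector.span_base)
  have P_out: "x - P x \<in> X" for x
    using B(1) by (simp add: X_def P_def cblinfun_linear cblinfun_scaleC \<phi> scaleC_complex_def if_distrib sum.delta cong: if_cong)
  have X_null: "x = 0" if xX: "x \<in> X" "x \<in> null_space T" for x
  proof -
    obtain u where u: "x = (\<Sum>b\<in>B. u b *\<^sub>C b)"
      using xX(2) complex_vector.span_finite[OF B(1)] B(3) by auto
    have "cblinfun_apply (\<phi> b) x = u b" if "b \<in> B" for b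
      using that B(1) unfolding u
      by (simp add: cblinfun_linear cblinfun_scaleC \<phi> scaleC_complex_def if_distrib sum.delta cong: if_cong)
    then show ?thesis using \<open>x \<in> X\<close> u by (simp add: X_def)
  qed
  define G where "G = {(x, y). x \<in> X \<and> y - cblinfun_apply T x \<in> Z}"
  have G: "(x, y) \<in> G \<longleftrightarrow> x \<in> X \<and> y - cblinfun_apply T x \<in> Z" for x y by (simp add: G_def)
  have G_add: "(x + x', y + y') \<in> G" if "(x, y) \<in> G" "(x', y') \<in> G" for x x' y y'
    using that complex_vector.subspace_add[OF X(1)] complex_vector.subspace_add[OF Z(1), of "y - cblinfun_apply T x" "y' - cblinfun_apply T x'"]
    by (simp add: G cblinfun_linear algebra_simps)
  have G_scale: "(c *\<^sub>C x, c *\<^sub>C y) \<in> G" if "(x, y) \<in> G" for c x y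
    using that complex_vector.subspace_scale[OF X(1)] complex_vector.subspace_scale[OF Z(1), of "y - cblinfun_apply T x" c]
    by (simp add: G cblinfun_scaleC complex_vector.scale_right_diff_distrib)
  have "subspace G"
  proof (rule subspaceI)
    show "0 \<in> G"
      using complex_vector.subspace_0[OF X(1)] complex_vector.subspace_0[OF Z(1)]
      by (simp add: zero_prod_def G cblinfun_linear)
    show "p + q \<in> G" if "p \<in> G" "q \<in> G" for p q
      using that G_add by (cases p, cases q) simp
    show "r *\<^sub>R p \<in> G" if "p \<in> G" for r p
      using that G_scale[of _ _ "complex_of_real r"] by (cases p) (simp add: scaleR_scaleC[where 'a = 'a] scaleR_scaleC[where 'a = 'b])
  qed
  moreover have "closed G"
  proof -
    have "G = fst -` X \<inter> (\<lambda>p. snd p - cblinfun_apply T (fst p)) -` Z"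
      by (auto simp: G_def)
    also have "closed \<dots>"
      by (intro closed_Int closed_vimage X Z continuous_intros)
    finally show ?thesis .
  qed
  moreover have surj: "\<exists>x. (x, y) \<in> G" for y
  proof -
    obtain x z where xz: "y = cblinfun_apply T x + z" "z \<in> Z" using Z(4) by blast
    have "cblinfun_apply T (P x) = 0" using P_in by (simp add: null_space_def)
    then have "(x - P x, y) \<in> G" using P_out xz by (simp add: G cblinfun_linear)
    then show ?thesis by blast
  qed
  ultimately obtain K where "\<And>y. \<exists>x. (x, y) \<in> G \<and> norm x \<le> K * norm y"
    using closed_relation_bounded_selection[of G] by metis
  then obtain s where s: "\<And>y. (s y, y) \<in> G" "\<And>y. norm (s y) \<le> K * norm y"
    by metis
  have uniq: "x = x'" if "(x, y) \<in> G" "(x', y) \<in> G" for x x' y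
  proof -
    have d: "(x - x', 0) \<in> G"
      using G_add[OF that(1) G_scale[OF that(2), of "-1"]] by simp
    then have "cblinfun_apply T (x - x') \<in> Z"
      using complex_vector.subspace_neg[OF Z(1)] unfolding G by fastforce
    then have "x - x' \<in> null_space T" using Z(3) by (auto simp: null_space_def)
    then show ?thesis using X_null[of "x - x'"] d by (simp add: G)
  qed
  have sl: "s (c *\<^sub>C y) = c *\<^sub>C s y" for c y
    using uniq[OF s(1) G_scale[OF s(1)]] .
  have "bounded_linear s"
  proof (rule bounded_linear_intro[where K = K])
    show "s (y + y') = s y + s y'" for y y' using uniq[OF s(1) G_add[OF s(1) s(1)]] .
    show "s (r *\<^sub>R y) = r *\<^sub>R s y" for r y using sl by (simp add: scaleR_scaleC)
    show "norm (s y) \<le> norm y * K" for y using s(2)[of y] by (simp add: mult.commute)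
  qed
  then have S: "cblinfun_apply (mk_cblinfun s) y = s y" for y
    using sl by (rule mk_cblinfun_apply)
  have "s (cblinfun_apply T x) = x - P x" for x
  proof (rule uniq[OF s(1)])
    show "(x - P x, cblinfun_apply T x) \<in> G"
      using P_in[of x] P_out[of x] complex_vector.subspace_0[OF Z(1)]
      by (simp add: G cblinfun_linear null_space_def)
  qed
  then have "x - cblinfun_apply (mk_cblinfun s) (cblinfun_apply T x) \<in> null_space T" for x
    using P_in[of x] by (simp add: S)
  moreover have "y - cblinfun_apply T (cblinfun_apply (mk_cblinfun s) y) \<in> Z" for y
    using s(1)[of y] by (simp add: S G)
  ultimately show ?thesis by blast
qed

text \<open>Let \<open>F = I - S T\<close>. On the kernel of \<open>F\<close> the operator \<open>S\<close> inverts \<open>T\<close>, so the image \<open>M\<close> of that kernel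
is closed; if \<open>E\<close> is a finite-dimensional complement of the kernel, the preimage of \<open>E\<close> under \<open>S\<close>
is a complement of \<open>M\<close>. The range of \<open>T\<close> is \<open>M\<close> together with the finite-dimensional image
of \<open>E\<close>.\<close>

lemma left_parametrix_imp_left_semi_Fredholm:
  fixes T S :: "'a::complex_normed_vector \<Rightarrow>\<^sub>C\<^sub>L 'a"
  assumes K: "finite K" and ST: "\<And>x. x - cblinfun_apply S (cblinfun_apply T x) \<in> cspan K"
  shows "T \<in> left_semi_Fredholm"
proof -
  define F where "F = cid - ccompose S T"
  have F: "cblinfun_apply F x = x - cblinfun_apply S (cblinfun_apply T x)" for x
    by (simp add: F_def cblinfun_apply_simps cid_apply ccompose_apply)
  have "range (cblinfun_apply F) \<subseteq> cspan K" using ST by (auto simp: F)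
  then obtain B where B: "finite B" "\<not> cdependent B" "cspan B = range (cblinfun_apply F)"
    using finite_dimensional_subspace_basis[OF csubspace_range _ K] by metis
  have "\<exists>x. cblinfun_apply F x = b" if "b \<in> B" for b
    using B(3) complex_vector.span_base[OF that] by auto
  then obtain e where e: "\<And>b. b \<in> B \<Longrightarrow> cblinfun_apply F (e b) = b" by metis
  have inj: "inj_on e B" using e by (metis inj_onI)
  define E where "E = cspan (e ` B)"
  have E_sum: "(\<Sum>b\<in>B. u b *\<^sub>C e b) \<in> E" for u
    unfolding E_def by (intro complex_vector.span_sum complex_vector.span_scale complex_vector.span_base imageI)
  have E_split: "\<exists>p\<in>E. cblinfun_apply F (x - p) = 0" for x
  proof -
    have "cblinfun_apply F x \<in> cspan B" using B(3) by blast
    then obtain u where u: "cblinfun_apply F x = (\<Sum>b\<in>B. u b *\<^sub>C b)"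
      unfolding complex_vector.span_finite[OF B(1)] by auto
    have "cblinfun_apply F (x - (\<Sum>b\<in>B. u b *\<^sub>C e b)) = 0"
      by (simp add: cblinfun_linear cblinfun_scaleC u e)
    then show ?thesis using E_sum by blast
  qed
  have E_ker: "x = 0" if x: "x \<in> E" "cblinfun_apply F x = 0" for x
  proof -
    obtain u where u: "x = (\<Sum>b\<in>B. u (e b) *\<^sub>C e b)"
      using x(1) complex_vector.span_finite[of "e ` B"] B(1) by (auto simp: E_def sum.reindex[OF inj])
    have "(\<Sum>b\<in>B. u (e b) *\<^sub>C b) = 0"
      using x(2) by (simp add: u cblinfun_linear cblinfun_scaleC e)
    then have "\<forall>b\<in>B. u (e b) = 0"
      using complex_vector.independentD[OF B(2,1) subset_refl, of "\<lambda>b. u (e b)"] by blast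
    then show ?thesis by (simp add: u)
  qed
  have E_csub: "csubspace E" unfolding E_def by (rule complex_vector.subspace_span)
  have E_closed: "closed E" unfolding E_def by (intro closed_cspan_finite finite_imageI B)
  define M where "M = cblinfun_apply T ` null_space F"
  define N where "N = {y. cblinfun_apply S y \<in> E}"
  have kerF: "cblinfun_apply S (cblinfun_apply T x) = x" if "x \<in> null_space F" for x
    using that by (simp add: null_space_def F)
  have "csubspace M" unfolding M_def by (intro csubspace_image csubspace_null_space)
  moreover have "closed M"
  proof -
    have "M = {y. cblinfun_apply T (cblinfun_apply S y) = y} \<inter> {y. cblinfun_apply F (cblinfun_apply S y) = 0}"
      unfolding M_def using kerF by (auto simp: null_space_def) (metis (mono_tags, lifting) image_eqI mem_Collect_eq)
    also have "closed \<dots>"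
      by (intro closed_Int closed_Collect_eq continuous_intros)
    finally show ?thesis .
  qed
  moreover have "csubspace N" "closed N"
    unfolding N_def by (intro csubspace_preimage closed_preimage E_csub E_closed)+
  moreover have "M \<inter> N = {0}"
  proof -
    have "y = 0" if "y \<in> M" "y \<in> N" for y
    proof -
      obtain x where x: "x \<in> null_space F" "y = cblinfun_apply T x" using \<open>y \<in> M\<close> unfolding M_def by blast
      then have "x \<in> E" using that kerF by (simp add: N_def)
      then have "x = 0" using E_ker x by (simp add: null_space_def)
      then show ?thesis using x by (simp add: cblinfun_linear)
    qed
    then show ?thesis
      using complex_vector.subspace_0[OF \<open>csubspace M\<close>] complex_vector.subspace_0[OF \<open>csubspace N\<close>] by blast
  qed
  moreover have "subspace_sum M N = UNIV"
  proof -
    have "y \<in> subspace_sum M N" for y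
    proof -
      obtain p where p: "p \<in> E" "cblinfun_apply F (cblinfun_apply S y - p) = 0" using E_split by blast
      let ?x = "cblinfun_apply S y - p"
      have x: "?x \<in> null_space F" using p by (simp add: null_space_def)
      have "cblinfun_apply T ?x \<in> M" using x by (simp add: M_def)
      moreover have "y - cblinfun_apply T ?x \<in> N"
        unfolding N_def mem_Collect_eq cblinfun_linear(2)[of S y] kerF[OF x] using p by simp
      moreover have "y = cblinfun_apply T ?x + (y - cblinfun_apply T ?x)" by simp
      ultimately show ?thesis by blast
    qed
    then show ?thesis by blast
  qed
  ultimately have "closed_complemented M" unfolding closed_complemented_def by blast
  then have "closed_complemented (subspace_sum M (cspan ((\<lambda>b. cblinfun_apply T (e b)) ` B)))"
    by (intro closed_complemented_add_span finite_imageI B)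
  moreover have "subspace_sum M (cspan ((\<lambda>b. cblinfun_apply T (e b)) ` B)) = range (cblinfun_apply T)"
  proof -
    have "cspan ((\<lambda>b. cblinfun_apply T (e b)) ` B) = cblinfun_apply T ` E" (is "cspan ?C = _")
    proof
      show "cspan ?C \<subseteq> cblinfun_apply T ` E"
        by (rule complex_vector.span_minimal) (auto simp: E_def intro: complex_vector.span_base
            csubspace_image complex_vector.subspace_span)
      have "E \<subseteq> {x. cblinfun_apply T x \<in> cspan ?C}"
        unfolding E_def by (rule complex_vector.span_minimal)
          (auto intro: complex_vector.span_base csubspace_preimage complex_vector.subspace_span)
      then show "cblinfun_apply T ` E \<subseteq> cspan ?C" by blast
    qed
    moreover have "cblinfun_apply T x \<in> subspace_sum M (cblinfun_apply T ` E)" for x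
    proof -
      obtain p where p: "p \<in> E" "cblinfun_apply F (x - p) = 0" using E_split by blast
      then have "cblinfun_apply T (x - p) \<in> M" by (simp add: M_def null_space_def)
      moreover have "cblinfun_apply T x = cblinfun_apply T (x - p) + cblinfun_apply T p"
        by (simp add: cblinfun_linear)
      ultimately show ?thesis using p by blast
    qed
    moreover have "subspace_sum M (cblinfun_apply T ` E) \<subseteq> range (cblinfun_apply T)"
      unfolding M_def using complex_vector.subspace_add[OF csubspace_range] by blast
    ultimately show ?thesis by auto
  qed
  moreover have "nullity T < \<infinity>"
  proof -
    have "null_space T \<subseteq> cspan K"
    proof
      fix x assume "x \<in> null_space T"
      then show "x \<in> cspan K" using ST[of x] by (simp add: null_space_def cblinfun_linear)
    qed
    then show ?thesis
      unfolding nullity_finite_iff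
      using finite_dimensional_subspace_basis[OF csubspace_null_space _ K] by metis
  qed
  ultimately show ?thesis by (simp add: left_semi_Fredholm_def)
qed

lemma left_semi_Fredholm_iff_left_parametrix:
  fixes T :: "'a::cbanach \<Rightarrow>\<^sub>C\<^sub>L 'a"
  shows "T \<in> left_semi_Fredholm \<longleftrightarrow>
    (\<exists>S K. finite K \<and> (\<forall>x. x - cblinfun_apply S (cblinfun_apply T x) \<in> cspan K))"
proof
  assume T: "T \<in> left_semi_Fredholm"
  then have "nullity T < \<infinity>" by (simp add: left_semi_Fredholm_def)
  then obtain K where K: "finite K" "cspan K = null_space T"
    unfolding nullity_finite_iff by blast
  obtain Z where "csubspace Z" "closed Z" "range (cblinfun_apply T) \<inter> Z = {0}"
      "subspace_sum (range (cblinfun_apply T)) Z = UNIV"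
    using T unfolding left_semi_Fredholm_def closed_complemented_def by blast
  then obtain S where "\<forall>x. x - cblinfun_apply S (cblinfun_apply T x) \<in> null_space T"
    using generalized_inverse[OF \<open>nullity T < \<infinity>\<close>, of Z] by blast
  then show "\<exists>S K. finite K \<and> (\<forall>x. x - cblinfun_apply S (cblinfun_apply T x) \<in> cspan K)"
    using K by metis
qed (use left_parametrix_imp_left_semi_Fredholm in blast)


section \<open>Dimensions, and the index of a triangular operator\<close>

abbreviation clinear :: "('a::complex_normed_vector \<Rightarrow> 'b::complex_normed_vector) \<Rightarrow> bool"
  where "clinear f \<equiv> Vector_Spaces.linear scaleC scaleC f"

lemma clinearI:
  assumes "\<And>x y. f (x + y) = f x + f y" "\<And>c x. f (c *\<^sub>C x) = c *\<^sub>C f x"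
  shows "clinear f"
  unfolding Vector_Spaces.linear_iff
  using assms complex_vector.vector_space_axioms[where 'a='a] complex_vector.vector_space_axioms[where 'a='b]
  by blast

lemma csubspace_clinear_image:
  assumes "clinear f" "csubspace U"
  shows "csubspace (f ` U)"
proof -
  interpret f: Vector_Spaces.linear scaleC scaleC f by fact
  show ?thesis using assms(2) unfolding csubspace_raw_def by (rule f.subspace_image)
qed

lemma clinear_cblinfun: "clinear (cblinfun_apply T)"
  by (rule clinearI) (simp_all add: cblinfun_linear cblinfun_scaleC)

lemma clinear_Pair_left: "clinear (\<lambda>x. (x, 0))"
  by (rule clinearI) (simp_all add: scaleC_prod_def)

lemma clinear_Pair_right: "clinear (\<lambda>x. (0, x))"
  by (rule clinearI) (simp_all add: scaleC_prod_def)

lemma clinear_snd: "clinear snd"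
  by (rule clinearI) (simp_all add: scaleC_prod_def)

lemma cedim_cspan: "finite B \<Longrightarrow> \<not> cdependent B \<Longrightarrow> cedim (cspan B) = enat (card B)"
  unfolding cedim_def by (auto simp: complex_vector.dim_eq_card_independent)

text \<open>The infinite case is put in the form in which it is refuted later: no finite set can span a larger
subspace either.\<close>

lemma cedim_cases:
  assumes "csubspace V"
  obtains B where "finite B" "\<not> cdependent B" "cspan B = V" "cedim V = enat (card B)"
  | "\<And>B. finite B \<Longrightarrow> \<not> V \<subseteq> cspan B" "cedim V = \<infinity>"
proof (cases "\<exists>B. finite B \<and> V \<subseteq> cspan B")
  case True
  then obtain K where "finite K" "V \<subseteq> cspan K" by blast
  then obtain B where B: "finite B" "\<not> cdependent B" "cspan B = V"
    using finite_dimensional_subspace_basis[OF assms] by metis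
  then have "cedim V = enat (card B)" using cedim_cspan by blast
  then show thesis using B that(1) by blast
next
  case False
  then have "\<not> (\<exists>B. finite B \<and> cspan B = V)" by blast
  then have "cedim V = \<infinity>" unfolding cedim_def by (rule if_not_P)
  then show thesis using False that(2) by blast
qed

lemma cedim_injective_image:
  assumes f: "clinear f" and U: "csubspace U" and inj: "inj_on f U"
  shows "cedim (f ` U) = cedim U"
proof -
  interpret f: Vector_Spaces.linear scaleC scaleC f by fact
  show ?thesis
  proof (cases rule: cedim_cases[OF U])
    case (1 B)
    then have "\<not> cdependent (f ` B)"
      using inj unfolding cdependent_raw_def cspan_raw_def by (intro f.independent_injective_image) auto
    moreover have "cspan (f ` B) = f ` U" using f.span_image[of B] 1 by (simp add: cspan_raw_def)
    moreover have "card (f ` B) = card B"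
      using 1 inj complex_vector.span_superset[of B] by (intro card_image) (auto intro: inj_on_subset)
    ultimately show ?thesis using cedim_cspan[of "f ` B"] 1 by simp
  next
    case 2
    have "csubspace (f ` U)" using f U by (rule csubspace_clinear_image)
    then show ?thesis
    proof (cases rule: cedim_cases)
      case (1 B)
      then have "B \<subseteq> f ` U" using complex_vector.span_superset by blast
      then obtain B' where B': "B' \<subseteq> U" "finite B'" "B = f ` B'"
        using \<open>finite B\<close> finite_subset_image by metis
      have "cspan B' \<subseteq> U" using B'(1) U by (rule complex_vector.span_minimal)
      have "U \<subseteq> cspan B'"
      proof
        fix x assume x: "x \<in> U"
        then have "f x \<in> f ` cspan B'" using f.span_image[of B'] B' 1 by (simp add: cspan_raw_def)
        then obtain y where "y \<in> cspan B'" "f x = f y" by blast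
        then show "x \<in> cspan B'" using inj x \<open>cspan B' \<subseteq> U\<close> by (metis inj_onD subsetD)
      qed
      then show ?thesis using 2 B' by blast
    next
      case 2
      then show ?thesis using \<open>cedim U = \<infinity>\<close> by simp
    qed
  qed
qed

lemma cedim_direct_sum:
  assumes U: "csubspace U" and V: "csubspace V" and UV: "U \<inter> V = {0}"
  shows "cedim (subspace_sum U V) = cedim U + cedim V"
proof -
  have S: "csubspace (subspace_sum U V)" using U V by (rule complex_vector.subspace_sums)
  have US: "U \<subseteq> subspace_sum U V"
    using subspace_sumI[OF _ complex_vector.subspace_0[OF V]] by auto
  have VS: "V \<subseteq> subspace_sum U V"
    using subspace_sumI[OF complex_vector.subspace_0[OF U]] by auto
  have inf: ?thesis if "W = U \<or> W = V" "\<And>B. finite B \<Longrightarrow> \<not> W \<subseteq> cspan B" "cedim W = \<infinity>" for W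
  proof (cases rule: cedim_cases[OF S])
    case (1 B)
    then show ?thesis using that US VS by metis
  next
    case 2
    then show ?thesis using that by auto
  qed
  show ?thesis
  proof (cases rule: cedim_cases[OF U])
    case 2
    then show ?thesis by (intro inf[of U]) auto
  next
    case BU: (1 BU)
    show ?thesis
    proof (cases rule: cedim_cases[OF V])
      case 2
      then show ?thesis by (intro inf[of V]) auto
    next
      case BV: (1 BV)
      have disj: "BU \<inter> BV = {}"
      proof -
        have "BU \<inter> BV \<subseteq> {0}"
          using BU(3) BV(3) UV complex_vector.span_superset by blast
        moreover have "0 \<notin> BU" using BU(2) complex_vector.dependent_zero by blast
        ultimately show ?thesis by blast
      qed
      have "u b = 0" if sum0: "(\<Sum>b\<in>BU \<union> BV. u b *\<^sub>C b) = 0" and b: "b \<in> BU \<union> BV" for u b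
      proof -
        let ?p = "\<Sum>b\<in>BU. u b *\<^sub>C b" and ?q = "\<Sum>b\<in>BV. u b *\<^sub>C b"
        have pq: "?p + ?q = 0"
          using sum0 by (simp add: sum.union_disjoint[OF BU(1) BV(1) disj])
        have p: "?p \<in> U" unfolding BU(3)[symmetric]
          by (intro complex_vector.span_sum complex_vector.span_scale complex_vector.span_base)
        have q: "?q \<in> V" unfolding BV(3)[symmetric]
          by (intro complex_vector.span_sum complex_vector.span_scale complex_vector.span_base)
        have "?p = - ?q" using pq by (simp add: add_eq_0_iff2)
        then have "?p \<in> V" using complex_vector.subspace_neg[OF V q] by (simp only:)
        then have p0: "?p = 0" using p UV by blast
        then have "?q = 0" using pq by simp
        then show ?thesis
          using b p0 complex_vector.independentD[OF BU(2,1) subset_refl]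
            complex_vector.independentD[OF BV(2,1) subset_refl] by blast
      qed
      then have "\<not> cdependent (BU \<union> BV)"
        using complex_vector.dependent_finite[of "BU \<union> BV"] BU(1) BV(1) by blast
      moreover have "cspan (BU \<union> BV) = subspace_sum U V"
        using complex_vector.span_Un[of BU BV] BU(3) BV(3) by simp
      ultimately have "cedim (subspace_sum U V) = enat (card (BU \<union> BV))"
        using cedim_cspan[of "BU \<union> BV"] BU(1) BV(1) by simp
      then show ?thesis
        using BU BV disj by (simp add: card_Un_disjoint)
    qed
  qed
qed

text \<open>This replaces bases of a quotient by bases of a complement, for which direct sums and injective
images are easy to handle.\<close>

lemma cecodim_eq_cedim_complement:
  assumes M: "csubspace M" and N: "csubspace N" and MN: "M \<inter> N = {0}" "subspace_sum M N = UNIV"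
  shows "cecodim M = cedim N"
proof (cases rule: cedim_cases[OF N])
  case (1 B)
  have "cbasis_mod M B"
    unfolding cbasis_mod_def
  proof (intro conjI allI impI ballI)
    fix F u v assume F: "finite F \<and> F \<subseteq> B \<and> (\<Sum>v\<in>F. u v *\<^sub>C v) \<in> M" and v: "v \<in> F"
    have "(\<Sum>v\<in>F. u v *\<^sub>C v) \<in> N"
      unfolding 1(3)[symmetric] using F
      by (intro complex_vector.span_sum complex_vector.span_scale complex_vector.span_base) blast
    then have "(\<Sum>v\<in>F. u v *\<^sub>C v) = 0" using F MN by blast
    then show "u v = 0" using complex_vector.independentD[OF 1(2)] F v by blast
  next
    fix x
    have "x \<in> subspace_sum M N" using MN(2) by simp
    then obtain m n where "m \<in> M" "n \<in> N" "x = m + n" by blast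
    then show "\<exists>y\<in>cspan B. x - y \<in> M" using 1 by (intro bexI[of _ n]) simp_all
  qed
  then show ?thesis using cecodim_eq_card[OF M 1(1)] 1(4) by simp
next
  case 2
  have "\<not> cbasis_mod M B" if B: "finite B" for B
  proof
    assume "cbasis_mod M B"
    then have span: "\<exists>y\<in>cspan B. x - y \<in> M" for x unfolding cbasis_mod_def by blast
    have "\<exists>n\<in>N. b - n \<in> M" for b
    proof -
      have "b \<in> subspace_sum M N" using MN(2) by simp
      then obtain m n where "m \<in> M" "n \<in> N" "b = m + n" by blast
      then show ?thesis by (intro bexI[of _ n]) simp_all
    qed
    then obtain p where p: "\<And>b. p b \<in> N" "\<And>b. b - p b \<in> M" by metis
    have "N \<subseteq> cspan (p ` B)"
    proof
      fix n assume n: "n \<in> N"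
      obtain y where "y \<in> cspan B" "n - y \<in> M" using span by blast
      then obtain u where y: "n - (\<Sum>b\<in>B. u b *\<^sub>C b) \<in> M"
        using complex_vector.span_finite[OF B] by auto
      let ?q = "\<Sum>b\<in>B. u b *\<^sub>C p b"
      have "(\<Sum>b\<in>B. u b *\<^sub>C (b - p b)) \<in> M"
        by (intro complex_vector.subspace_sum[OF M] complex_vector.subspace_scale[OF M] p)
      from complex_vector.subspace_add[OF M y this] have "n - ?q \<in> M"
        by (simp add: complex_vector.scale_right_diff_distrib sum_subtractf)
      moreover have "?q \<in> N"
        by (intro complex_vector.subspace_sum[OF N] complex_vector.subspace_scale[OF N] p)
      then have "n - ?q \<in> N" using complex_vector.subspace_diff[OF N n] by blast
      ultimately have "n - ?q = 0" using MN(1) by blast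
      then have "n = ?q" by simp
      moreover have "?q \<in> cspan (p ` B)"
        by (intro complex_vector.span_sum complex_vector.span_scale complex_vector.span_base imageI)
      ultimately show "n \<in> cspan (p ` B)" by (simp only:)
    qed
    then show False using 2(1) B by blast
  qed
  then have "\<not> (\<exists>B. finite B \<and> cbasis_mod M B)" by blast
  then have "cecodim M = \<infinity>" unfolding cecodim_def by (rule if_not_P)
  then show ?thesis using 2 by simp
qed

text \<open>Extend a basis of \<open>M\<close> to one of \<open>U\<close> and take the span of the added vectors.\<close>

lemma csubspace_complement_exists:
  assumes M: "csubspace M" and U: "csubspace U" and MU: "M \<subseteq> U"
  shows "\<exists>W. csubspace W \<and> W \<subseteq> U \<and> M \<inter> W = {0} \<and> subspace_sum M W = U"
proof -
  obtain b where b: "b \<subseteq> M" "\<not> cdependent b" "M \<subseteq> cspan b"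
    using complex_vector.maximal_independent_subset by blast
  obtain B where B: "b \<subseteq> B" "B \<subseteq> U" "\<not> cdependent B" "U \<subseteq> cspan B"
    using complex_vector.maximal_independent_subset_extend[of b U] b MU by blast
  have sb: "cspan b = M" using b complex_vector.span_minimal[OF b(1) M] by blast
  have sB: "cspan B = U" using B complex_vector.span_minimal[OF B(2) U] by blast
  define W where "W = cspan (B - b)"
  have "csubspace W" unfolding W_def by (rule complex_vector.subspace_span)
  moreover have "W \<subseteq> U" unfolding W_def sB[symmetric] by (rule complex_vector.span_mono) blast
  moreover have "M \<inter> W = {0}"
  proof -
    have "x = 0" if x: "x \<in> M" "x \<in> W" for x
    proof -
      have "complex_vector.representation B x = complex_vector.representation b x"
        using B(3) x(1) B(1) unfolding sb[symmetric] by (rule complex_vector.representation_extend)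
      moreover have "complex_vector.representation B x = complex_vector.representation (B - b) x"
        using B(3) x(2) unfolding W_def by (rule complex_vector.representation_extend) blast
      ultimately have "complex_vector.representation B x v = 0" for v
        using complex_vector.representation_ne_zero[of b x v] complex_vector.representation_ne_zero[of "B - b" x v]
        by (metis Diff_iff)
      moreover have "x \<in> cspan B" using x(1) MU sB by blast
      ultimately show ?thesis
        using complex_vector.sum_nonzero_representation_eq[OF B(3), of x] by simp
    qed
    then show ?thesis
      using complex_vector.subspace_0[OF M] complex_vector.subspace_0[OF \<open>csubspace W\<close>] by blast
  qed
  moreover have "subspace_sum M W = U"
  proof -
    have "b \<union> (B - b) = B" using B(1) by blast
    then show ?thesis using complex_vector.span_Un[of b "B - b"] sb sB by (simp add: W_def)
  qed
  ultimately show ?thesis by (intro exI[of _ W] conjI)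
qed

text \<open>Here \<open>k\<close> is the dimension of a complement \<open>W\<close>, in the null space of \<open>B\<close>, of the subspace \<open>K\<close> of those
\<open>y\<close> whose image \<open>C y\<close> lies in the range of \<open>A\<close>. A null vector of \<open>B\<close> lifts to one of the triangular
operator exactly when it lies in \<open>K\<close>, so the nullity loses the dimension of \<open>W\<close>. The operator \<open>C\<close>
embeds \<open>W\<close> into \<open>X\<close> modulo the range of \<open>A\<close>, and there it enlarges the range of the triangular
operator, so the deficiency loses the same dimension.\<close>

lemma upper_triangular_nullity_deficiency:
  fixes A :: "'x::complex_normed_vector \<Rightarrow>\<^sub>C\<^sub>L 'x" and B :: "'y::complex_normed_vector \<Rightarrow>\<^sub>C\<^sub>L 'y"
  shows "\<exists>k \<le> nullity B. nullity (upper_triangular A C B) + k = nullity A + nullity B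
    \<and> deficiency (upper_triangular A C B) + k = deficiency A + deficiency B"
proof -
  let ?M = "upper_triangular A C B"
  let ?RA = "range (cblinfun_apply A)" and ?RB = "range (cblinfun_apply B)"
  let ?RM = "range (cblinfun_apply ?M)"
  define K where "K = null_space B \<inter> {y. cblinfun_apply C y \<in> ?RA}"
  have K: "csubspace K"
    unfolding K_def by (intro complex_vector.subspace_inter csubspace_null_space csubspace_preimage csubspace_range)
  have KB: "K \<subseteq> null_space B" by (simp add: K_def)
  obtain W where W: "csubspace W" "W \<subseteq> null_space B" "K \<inter> W = {0}" "subspace_sum K W = null_space B"
    using csubspace_complement_exists[OF K csubspace_null_space KB] by (elim exE conjE) (rule that)
  define CW where "CW = cblinfun_apply C ` W"
  have CW: "csubspace CW" unfolding CW_def using W(1) by (rule csubspace_image)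
  have CW_in: "w = 0" if "w \<in> W" "cblinfun_apply C w \<in> ?RA" for w
    using that W(2,3) by (auto simp: K_def)
  have zero_RA: "0 \<in> ?RA" by (rule complex_vector.subspace_0[OF csubspace_range])
  have injC: "inj_on (cblinfun_apply C) W"
  proof (rule inj_onI)
    fix w w' assume ww: "w \<in> W" "w' \<in> W" "cblinfun_apply C w = cblinfun_apply C w'"
    then have "cblinfun_apply C (w - w') \<in> ?RA" using zero_RA by (simp add: cblinfun_linear)
    then have "w - w' = 0" using CW_in complex_vector.subspace_diff[OF W(1) ww(1,2)] by blast
    then show "w = w'" by simp
  qed
  have dimCW: "cedim CW = cedim W"
    unfolding CW_def using clinear_cblinfun W(1) injC by (rule cedim_injective_image)
  have RACW: "?RA \<inter> CW = {0}"
  proof -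
    have "v = 0" if "v \<in> ?RA" "v \<in> CW" for v
    proof -
      obtain w where w: "w \<in> W" "v = cblinfun_apply C w" using \<open>v \<in> CW\<close> unfolding CW_def by blast
      then have "w = 0" using CW_in \<open>v \<in> ?RA\<close> by simp
      then show ?thesis using w by (simp add: cblinfun_linear)
    qed
    then show ?thesis using zero_RA complex_vector.subspace_0[OF CW] by blast
  qed
  have S: "csubspace (subspace_sum ?RA CW)"
    by (intro complex_vector.subspace_sums csubspace_range CW)
  \<comment> \<open>\<open>CW + D\<close> complements the range of \<open>A\<close>, \<open>E\<close> that of \<open>B\<close>, and \<open>D \<times> E\<close> that of the triangular
    operator.\<close>
  obtain D where D: "csubspace D" "subspace_sum ?RA CW \<inter> D = {0}" "subspace_sum (subspace_sum ?RA CW) D = UNIV"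
    using csubspace_complement_exists[OF S complex_vector.subspace_UNIV subset_UNIV] by (elim exE conjE) (rule that)
  obtain E where E: "csubspace E" "?RB \<inter> E = {0}" "subspace_sum ?RB E = UNIV"
    using csubspace_complement_exists[OF csubspace_range[of B] complex_vector.subspace_UNIV subset_UNIV] by (elim exE conjE) (rule that)
  have CWD: "CW \<inter> D = {0}"
  proof -
    have "CW \<subseteq> subspace_sum ?RA CW" using subspace_sumI[OF zero_RA] by auto
    then show ?thesis
      using D(2) complex_vector.subspace_0[OF CW] complex_vector.subspace_0[OF D(1)] by blast
  qed
  have defA: "deficiency A = cedim W + cedim D"
  proof -
    have "cecodim ?RA = cedim (subspace_sum CW D)"
    proof (rule cecodim_eq_cedim_complement[OF csubspace_range])
      show sCWD: "csubspace (subspace_sum CW D)" using CW D(1) by (rule complex_vector.subspace_sums)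
      show "subspace_sum ?RA (subspace_sum CW D) = UNIV"
        using D(3) subspace_sum_assoc[of ?RA CW D] by simp
      have "v = 0" if v: "v \<in> ?RA" "v \<in> subspace_sum CW D" for v
      proof -
        obtain c d where cd: "c \<in> CW" "d \<in> D" "v = c + d" using v(2) by blast
        have "- c \<in> CW" using complex_vector.subspace_neg[OF CW cd(1)] .
        then have "d \<in> subspace_sum ?RA CW"
          using v(1) cd by (intro subspace_sumI[of v _ "- c"]) simp_all
        then have "d = 0" using cd D(2) by blast
        then show ?thesis using cd v RACW by auto
      qed
      then show "?RA \<inter> subspace_sum CW D = {0}"
        using zero_RA complex_vector.subspace_0[OF sCWD] by blast
    qed
    also have "\<dots> = cedim W + cedim D"
      using cedim_direct_sum[OF CW D(1) CWD] dimCW by simp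
    finally show ?thesis by (simp add: deficiency_def)
  qed
  have defB: "deficiency B = cedim E"
    unfolding deficiency_def by (rule cecodim_eq_cedim_complement[OF csubspace_range E])
  define D' where "D' = (\<lambda>x. (x, 0::'y)) ` D"
  define E' where "E' = (\<lambda>y. (0::'x, y)) ` E"
  have D'E': "csubspace D'" "csubspace E'"
    unfolding D'_def E'_def
    by (intro csubspace_clinear_image clinear_Pair_left clinear_Pair_right D(1) E(1))+
  have dimD': "cedim D' = cedim D"
    unfolding D'_def by (rule cedim_injective_image[OF clinear_Pair_left D(1)]) (auto intro: inj_onI)
  have dimE': "cedim E' = cedim E"
    unfolding E'_def by (rule cedim_injective_image[OF clinear_Pair_right E(1)]) (auto intro: inj_onI)
  have D'E'0: "D' \<inter> E' = {0}"
    using complex_vector.subspace_0[OF D(1)] complex_vector.subspace_0[OF E(1)]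
    by (auto simp: D'_def E'_def zero_prod_def)
  have D'E'_iff: "p \<in> subspace_sum D' E' \<longleftrightarrow> fst p \<in> D \<and> snd p \<in> E" for p
  proof
    show "fst p \<in> D \<and> snd p \<in> E" if "p \<in> subspace_sum D' E'"
      using that by (auto simp: D'_def E'_def)
    show "p \<in> subspace_sum D' E'" if "fst p \<in> D \<and> snd p \<in> E"
      using that by (intro subspace_sumI[of "(fst p, 0)" _ "(0, snd p)"]) (auto simp: D'_def E'_def)
  qed
  have sDE: "csubspace (subspace_sum D' E')" using D'E' by (rule complex_vector.subspace_sums)
  have defM: "deficiency ?M = cedim D + cedim E"
  proof -
    have "cecodim ?RM = cedim (subspace_sum D' E')"
    proof (rule cecodim_eq_cedim_complement[OF csubspace_range sDE])
      have "p = 0" if p: "p \<in> ?RM" "p \<in> subspace_sum D' E'" for p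
      proof -
        obtain x y where xy: "fst p = cblinfun_apply A x + cblinfun_apply C y" "snd p = cblinfun_apply B y"
          using p(1) by (auto simp: upper_triangular_apply)
        have "snd p \<in> E" "fst p \<in> D" using p(2) unfolding D'E'_iff by blast+
        then have s0: "snd p = 0" using E(2) xy(2) by blast
        then have "y \<in> subspace_sum K W" using xy(2) W(4) by (simp add: null_space_def)
        then obtain z w where zw: "z \<in> K" "w \<in> W" "y = z + w" by blast
        have "cblinfun_apply A x + cblinfun_apply C z \<in> ?RA"
          using zw(1) by (intro complex_vector.subspace_add csubspace_range) (auto simp: K_def)
        then have "fst p \<in> subspace_sum ?RA CW"
          using zw by (intro subspace_sumI[of "cblinfun_apply A x + cblinfun_apply C z" _ "cblinfun_apply C w"])
            (auto simp: xy CW_def cblinfun_linear add.assoc)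
        then have "fst p = 0" using \<open>fst p \<in> D\<close> D(2) by blast
        then show ?thesis using s0 by (simp add: prod_eq_iff)
      qed
      then show "?RM \<inter> subspace_sum D' E' = {0}"
        using complex_vector.subspace_0[OF csubspace_range, of ?M] complex_vector.subspace_0[OF sDE] by blast
      have "(u, v) \<in> subspace_sum ?RM (subspace_sum D' E')" for u v
      proof -
        have "v \<in> subspace_sum ?RB E" using E(3) by simp
        then obtain y e where ye: "v = cblinfun_apply B y + e" "e \<in> E" by blast
        have "u - cblinfun_apply C y \<in> subspace_sum (subspace_sum ?RA CW) D" using D(3) by simp
        then obtain x w d where xd: "u - cblinfun_apply C y = (cblinfun_apply A x + cblinfun_apply C w) + d" "w \<in> W" "d \<in> D"
          by (auto simp: CW_def)
        have Bw: "cblinfun_apply B w = 0" using xd(2) W(2) by (auto simp: null_space_def)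
        have u: "u = cblinfun_apply A x + (cblinfun_apply C y + cblinfun_apply C w) + d"
          using xd(1) by (simp add: algebra_simps)
        show ?thesis
        proof (rule subspace_sumI)
          show "cblinfun_apply ?M (x, y + w) \<in> ?RM" by blast
          show "(d, e) \<in> subspace_sum D' E'" unfolding D'E'_iff using xd ye by simp
          show "(u, v) = cblinfun_apply ?M (x, y + w) + (d, e)"
            using u ye Bw by (simp add: upper_triangular_apply cblinfun_linear)
        qed
      qed
      then show "subspace_sum ?RM (subspace_sum D' E') = UNIV" by auto
    qed
    also have "\<dots> = cedim D + cedim E"
      using cedim_direct_sum[OF D'E' D'E'0] dimD' dimE' by simp
    finally show ?thesis by (simp add: deficiency_def)
  qed
  have nullB: "nullity B = cedim K + cedim W"
    unfolding nullity_def using cedim_direct_sum[OF K W(1,3)] W(4) by simp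
  have NM: "(x, y) \<in> null_space ?M \<longleftrightarrow> cblinfun_apply A x + cblinfun_apply C y = 0 \<and> cblinfun_apply B y = 0" for x y
    by (simp add: null_space_def upper_triangular_apply zero_prod_def)
  define N where "N = (\<lambda>x. (x, 0::'y)) ` null_space A"
  have N: "csubspace N"
    unfolding N_def
    by (intro csubspace_clinear_image clinear_Pair_left csubspace_null_space)
  have NM': "N \<subseteq> null_space ?M"
    by (auto simp: N_def NM cblinfun_linear) (simp add: null_space_def)
  obtain V where V: "csubspace V" "V \<subseteq> null_space ?M" "N \<inter> V = {0}" "subspace_sum N V = null_space ?M"
    using csubspace_complement_exists[OF N csubspace_null_space NM'] by (elim exE conjE) (rule that)
  have "snd ` V = K"
  proof
    show "snd ` V \<subseteq> K"
    proof
      fix y assume "y \<in> snd ` V"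
      then obtain x where "(x, y) \<in> null_space ?M" using V(2) by auto
      then have "cblinfun_apply A x + cblinfun_apply C y = 0" "y \<in> null_space B"
        unfolding NM by (auto simp: null_space_def)
      moreover from this(1) have "cblinfun_apply C y = cblinfun_apply A (- x)"
        by (simp add: cblinfun_linear eq_neg_iff_add_eq_0 add.commute)
      ultimately show "y \<in> K" by (simp add: K_def)
    qed
    show "K \<subseteq> snd ` V"
    proof
      fix y assume "y \<in> K"
      then obtain x where x: "cblinfun_apply C y = cblinfun_apply A x" "cblinfun_apply B y = 0"
        by (auto simp: K_def null_space_def)
      then have "(- x, y) \<in> subspace_sum N V" unfolding V(4) NM by (simp add: cblinfun_linear)
      then obtain n v where nv: "n \<in> N" "v \<in> V" "(- x, y) = n + v" by blast
      then have "snd v = snd (n + v)" by (auto simp: N_def)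
      then have "snd v = y" using nv(3) by (metis snd_conv)
      then show "y \<in> snd ` V" using nv(2) by blast
    qed
  qed
  moreover have "inj_on snd V"
  proof (rule inj_onI)
    fix v v' assume v: "v \<in> V" "v' \<in> V" "snd v = snd v'"
    have d: "v - v' \<in> V" using complex_vector.subspace_diff[OF V(1) v(1,2)] .
    have "(fst (v - v'), snd (v - v')) \<in> null_space ?M"
      unfolding prod.collapse using d V(2) by (rule subsetD[rotated])
    then have "fst (v - v') \<in> null_space A" unfolding NM using v(3) by (simp add: cblinfun_linear null_space_def)
    moreover have "v - v' = (fst (v - v'), 0)" using v(3) by (simp add: prod_eq_iff)
    ultimately have "v - v' \<in> N" unfolding N_def by (rule image_eqI[rotated])
    then have "v - v' = 0" using d V(3) by blast
    then show "v = v'" by simp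
  qed
  ultimately have "cedim V = cedim K"
    using cedim_injective_image[OF clinear_snd V(1)] by simp
  moreover have "cedim N = nullity A"
    unfolding N_def nullity_def
    by (rule cedim_injective_image[OF clinear_Pair_left csubspace_null_space]) (auto intro: inj_onI)
  ultimately have nullM: "nullity ?M = nullity A + cedim K"
    unfolding nullity_def using cedim_direct_sum[OF N V(1,3)] V(4) by simp
  show ?thesis
  proof (intro exI[of _ "cedim W"] conjI)
    show "cedim W \<le> nullity B" by (simp add: nullB)
    show "nullity ?M + cedim W = nullity A + nullity B" by (simp add: nullM nullB add.assoc)
    show "deficiency ?M + cedim W = deficiency A + deficiency B"
      by (simp add: defM defA defB ac_simps)
  qed
qed


section \<open>The single valued extension property and the index\<close>

text \<open>Gaussian elimination for a homogeneous system with more unknowns than equations whose coefficients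
are holomorphic. Where a pivot function does not vanish, an open condition, the unknown \<open>j1\<close> can be
solved for; passing to a smaller open set at every step avoids any division with
singularities. Some unknown is never solved for, and it may be taken to be 1.\<close>

lemma holomorphic_nontrivial_kernel:
  fixes a :: "'i \<Rightarrow> 'j \<Rightarrow> complex \<Rightarrow> complex"
  assumes "finite I" "finite J" "card I < card J" "open V" "V \<noteq> {}"
    and "\<And>i j. i \<in> I \<Longrightarrow> j \<in> J \<Longrightarrow> a i j holomorphic_on V"
  shows "\<exists>V' c. open V' \<and> V' \<noteq> {} \<and> V' \<subseteq> V \<and> (\<forall>j\<in>J. c j holomorphic_on V') \<and>
    (\<forall>i\<in>I. \<forall>z\<in>V'. (\<Sum>j\<in>J. c j z * a i j z) = 0) \<and> (\<exists>j\<in>J. \<forall>z\<in>V'. c j z = 1)"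
  using assms
proof (induction I arbitrary: J V a rule: finite_induct)
  case empty
  then have "J \<noteq> {}" by auto
  then show ?case
    using empty by (intro exI[of _ V] exI[of _ "\<lambda>_ _. 1"]) (auto intro: holomorphic_intros)
next
  case (insert i I)
  show ?case
  proof (cases "\<forall>j\<in>J. \<forall>z\<in>V. a i j z = 0")
    case True
    have "card I < card J" using insert.prems(2) insert.hyps by simp
    then obtain V' c where V': "open V'" "V' \<noteq> {}" "V' \<subseteq> V" "\<forall>j\<in>J. c j holomorphic_on V'"
      "\<forall>i\<in>I. \<forall>z\<in>V'. (\<Sum>j\<in>J. c j z * a i j z) = 0" "\<exists>j\<in>J. \<forall>z\<in>V'. c j z = 1"
      using insert.IH[OF insert.prems(1) _ insert.prems(3,4), of a] insert.prems(5) by blast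
    moreover have "(\<Sum>j\<in>J. c j z * a i j z) = 0" if "z \<in> V'" for z
      using True V'(3) that by (intro sum.neutral) auto
    ultimately show ?thesis by (intro exI[of _ V'] exI[of _ c]) simp
  next
    case False
    then obtain j1 z1 where j1: "j1 \<in> J" "z1 \<in> V" "a i j1 z1 \<noteq> 0" by blast
    define U where "U = V \<inter> a i j1 -` (- {0})"
    have "open U"
      unfolding U_def
      using holomorphic_on_imp_continuous_on[OF insert.prems(5)[OF insertI1 j1(1)]] insert.prems(3)
      by (intro continuous_open_preimage) auto
    have "z1 \<in> U" using j1 by (simp add: U_def)
    have UV: "U \<subseteq> V" by (simp add: U_def)
    have piv: "a i j1 z \<noteq> 0" if "z \<in> U" for z using that by (simp add: U_def)
    have hol: "a k j holomorphic_on U" if "k \<in> insert i I" "j \<in> J" for k j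
      using insert.prems(5)[OF that] UV by (rule holomorphic_on_subset)
    define a' where "a' k j z = a k j z - a i j z * a k j1 z / a i j1 z" for k j z
    have "finite (J - {j1})" using insert.prems(1) by simp
    moreover have "card I < card (J - {j1})"
      using insert.prems(1,2) insert.hyps j1(1) by simp
    moreover have "a' k j holomorphic_on U" if "k \<in> I" "j \<in> J - {j1}" for k j
      unfolding a'_def using that j1(1) piv by (intro holomorphic_intros hol) auto
    ultimately obtain V' c where V': "open V'" "V' \<noteq> {}" "V' \<subseteq> U" "\<forall>j\<in>J - {j1}. c j holomorphic_on V'"
      "\<forall>k\<in>I. \<forall>z\<in>V'. (\<Sum>j\<in>J - {j1}. c j z * a' k j z) = 0" "\<exists>j\<in>J - {j1}. \<forall>z\<in>V'. c j z = 1"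
      using insert.IH[of "J - {j1}" U a'] \<open>open U\<close> \<open>z1 \<in> U\<close> by blast
    define s where "s z = (\<Sum>j\<in>J - {j1}. c j z * a i j z)" for z
    define c' where "c' j z = (if j = j1 then - s z / a i j1 z else c j z)" for j z
    have c'_sum: "(\<Sum>j\<in>J. c' j z * a k j z) = - s z / a i j1 z * a k j1 z + (\<Sum>j\<in>J - {j1}. c j z * a k j z)" for k z
      using insert.prems(1) j1(1) by (subst sum.remove[of _ j1]) (auto simp: c'_def intro!: sum.cong)
    have "s holomorphic_on V'"
      unfolding s_def using V'(3,4) by (intro holomorphic_intros holomorphic_on_subset[OF hol V'(3)]) auto
    then have "(\<lambda>z. - s z / a i j1 z) holomorphic_on V'"
      using V'(3) piv j1(1) by (intro holomorphic_intros holomorphic_on_subset[OF hol V'(3)]) auto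
    then have hol1: "c' j1 holomorphic_on V'" by (simp add: c'_def[abs_def])
    have "c' j holomorphic_on V'" if "j \<in> J - {j1}" for j
      using that V'(4) by (simp add: c'_def[abs_def])
    then have "\<forall>j\<in>J. c' j holomorphic_on V'" using hol1 by blast
    moreover have "(\<Sum>j\<in>J. c' j z * a k j z) = 0" if k: "k \<in> insert i I" and z: "z \<in> V'" for k z
    proof (cases "k = i")
      case True
      then show ?thesis using piv[of z] V'(3) z by (auto simp: c'_sum s_def)
    next
      case False
      then have "(\<Sum>j\<in>J - {j1}. c j z * a' k j z) = 0" using V'(5) k z by blast
      moreover have "(\<Sum>j\<in>J - {j1}. c j z * a' k j z)
          = (\<Sum>j\<in>J - {j1}. c j z * a k j z) - s z * a k j1 z / a i j1 z"
        unfolding a'_def s_def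
        by (simp add: right_diff_distrib sum_subtractf sum_distrib_right sum_divide_distrib mult.assoc)
      ultimately show ?thesis by (simp add: c'_sum)
    qed
    moreover have "\<exists>j\<in>J. \<forall>z\<in>V'. c' j z = 1"
      using V'(6) by (auto simp: c'_def)
    ultimately show ?thesis
      using V'(1-3) UV by (intro exI[of _ V'] exI[of _ c']) auto
  qed
qed

lemma vanalytic_on_scaleC:
  assumes V: "open V" and c: "c holomorphic_on V" and x: "vanalytic_on x V"
  shows "vanalytic_on (\<lambda>z. c z *\<^sub>C (x z :: 'a::complex_normed_vector)) V"
  unfolding vanalytic_on_def
proof
  fix z assume z: "z \<in> V"
  obtain D where D: "(c has_field_derivative D) (at z)"
    using c z V by (auto simp: holomorphic_on_open)
  obtain d where d: "(x has_derivative (\<lambda>h. h *\<^sub>C d)) (at z)"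
    using x z by (auto simp: vanalytic_on_def)
  have bil: "bounded_bilinear (\<lambda>(c::complex) (x::'a). c *\<^sub>C x)"
  proof
    show "\<exists>K. \<forall>a (b::'a). norm (a *\<^sub>C b) \<le> norm a * norm b * K"
      by (rule exI[of _ 1]) (simp add: norm_scaleC)
  qed (simp_all add: scaleC_add_left scaleC_add_right scaleR_scaleC scaleC_scaleC scaleC_complex_def mult.commute)
  have "((\<lambda>z. c z *\<^sub>C x z) has_derivative (\<lambda>h. c z *\<^sub>C (h *\<^sub>C d) + (D * h) *\<^sub>C x z)) (at z)"
    using bounded_bilinear.FDERIV[OF bil D[unfolded has_field_derivative_def] d] .
  also have "(\<lambda>h. c z *\<^sub>C (h *\<^sub>C d) + (D * h) *\<^sub>C x z) = (\<lambda>h. h *\<^sub>C (c z *\<^sub>C d + D *\<^sub>C x z))"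
    by (simp add: scaleC_add_right scaleC_scaleC mult.commute)
  finally show "\<exists>d. ((\<lambda>z. c z *\<^sub>C x z) has_derivative (\<lambda>h. h *\<^sub>C d)) (at z)" by blast
qed

lemma vanalytic_on_sum:
  assumes "\<And>i. i \<in> I \<Longrightarrow> vanalytic_on (f i) V"
  shows "vanalytic_on (\<lambda>z. \<Sum>i\<in>I. (f i z :: 'a::complex_normed_vector)) V"
  unfolding vanalytic_on_def
proof
  fix z assume z: "z \<in> V"
  have "\<forall>i\<in>I. \<exists>d. (f i has_derivative (\<lambda>h. h *\<^sub>C d)) (at z)"
    using assms z by (auto simp: vanalytic_on_def)
  then obtain d where d: "\<And>i. i \<in> I \<Longrightarrow> (f i has_derivative (\<lambda>h. h *\<^sub>C d i)) (at z)"
    by metis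
  have "((\<lambda>z. \<Sum>i\<in>I. f i z) has_derivative (\<lambda>h. \<Sum>i\<in>I. h *\<^sub>C d i)) (at z)"
    by (intro has_derivative_sum d)
  then show "\<exists>d. ((\<lambda>z. \<Sum>i\<in>I. f i z) has_derivative (\<lambda>h. h *\<^sub>C d)) (at z)"
    unfolding complex_vector.scale_sum_right[symmetric] by blast
qed

lemma holomorphic_on_functional:
  fixes \<phi> :: "'a::complex_normed_vector cdual"
  assumes "vanalytic_on f V" "open V"
  shows "(\<lambda>z. cblinfun_apply \<phi> (f z)) holomorphic_on V"
  unfolding holomorphic_on_open[OF assms(2)]
proof
  fix z assume "z \<in> V"
  then obtain d where d: "(f has_derivative (\<lambda>h. h *\<^sub>C d)) (at z)"
    using assms by (auto simp: vanalytic_on_def)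
  have "((\<lambda>z. cblinfun_apply \<phi> (f z)) has_derivative (\<lambda>h. cblinfun_apply \<phi> (h *\<^sub>C d))) (at z)"
    using bounded_linear.has_derivative[OF bounded_linear_cblinfun d] .
  also have "(\<lambda>h. cblinfun_apply \<phi> (h *\<^sub>C d)) = (*) (cblinfun_apply \<phi> d)"
    by (auto simp: cblinfun_scaleC scaleC_complex_def)
  finally show "\<exists>f'. ((\<lambda>z. cblinfun_apply \<phi> (f z)) has_field_derivative f') (at z)"
    unfolding has_field_derivative_def by blast
qed

text \<open>\<open>R \<mu> n = (I - \<mu>S)\<^sup>-\<^sup>1 n\<close>, obtained as the fixed point of a contraction. The fixed point equation
bounds its solution by twice its constant term, and the error of the linear
approximation satisfies such an equation with a constant term of order \<open>(\<mu> - \<nu>)\<^sup>2\<close>.\<close>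

lemma analytic_resolvent:
  fixes S :: "'a::cbanach \<Rightarrow>\<^sub>C\<^sub>L 'a"
  shows "\<exists>R \<delta>. \<delta> > 0 \<and> (\<forall>\<mu>\<in>ball 0 \<delta>. \<forall>n. R \<mu> n = n + \<mu> *\<^sub>C cblinfun_apply S (R \<mu> n)) \<and>
    (\<forall>n. vanalytic_on (\<lambda>\<mu>. R \<mu> n) (ball 0 \<delta>))"
proof -
  \<comment> \<open>The summand 1 covers the case \<open>S = 0\<close>; on the disc of radius \<open>\<delta>\<close> the operator \<open>\<mu> S\<close> has
    norm at most \<open>1/2\<close>.\<close>
  define \<delta> where "\<delta> = 1 / (2 * (norm S + 1))"
  have pos: "norm S + 1 > 0" using norm_ge_zero[of S] by linarith
  have \<delta>: "\<delta> > 0" using pos by (simp add: \<delta>_def)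
  have half: "norm (\<mu> *\<^sub>C cblinfun_apply S x) \<le> 1/2 * norm x" if "\<mu> \<in> ball 0 \<delta>" for \<mu> x
  proof -
    have "cmod \<mu> \<le> \<delta>" using that by simp
    then have "cmod \<mu> * norm S \<le> \<delta> * (norm S + 1)" by (intro mult_mono) (use \<delta> in auto)
    also have "\<dots> = 1/2" using pos by (simp add: \<delta>_def)
    finally have "cmod \<mu> * norm S * norm x \<le> 1/2 * norm x" by (rule mult_right_mono) simp
    moreover have "norm (\<mu> *\<^sub>C cblinfun_apply S x) \<le> cmod \<mu> * (norm S * norm x)"
      unfolding norm_scaleC by (intro mult_left_mono norm_cblinfun_apply) simp
    ultimately show ?thesis by simp
  qed
  have "\<exists>x. x = n + \<mu> *\<^sub>C cblinfun_apply S x" if \<mu>: "\<mu> \<in> ball 0 \<delta>" for \<mu> n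
  proof -
    have "dist (n + \<mu> *\<^sub>C cblinfun_apply S x) (n + \<mu> *\<^sub>C cblinfun_apply S y) \<le> 1/2 * dist x y" for x y
      using half[OF \<mu>, of "x - y"]
      by (simp add: dist_norm cblinfun_linear complex_vector.scale_right_diff_distrib)
    then have "\<exists>!x. n + \<mu> *\<^sub>C cblinfun_apply S x = x"
      by (intro banach_fix_type[of "1/2"]) auto
    then show ?thesis by metis
  qed
  then obtain R where R: "\<And>\<mu> n. \<mu> \<in> ball 0 \<delta> \<Longrightarrow> R \<mu> n = n + \<mu> *\<^sub>C cblinfun_apply S (R \<mu> n)"
    by metis
  have bound: "norm e \<le> 2 * norm n" if \<mu>: "\<mu> \<in> ball 0 \<delta>" and e: "e = n + \<mu> *\<^sub>C cblinfun_apply S e" for \<mu> n e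
  proof -
    have "norm (n + \<mu> *\<^sub>C cblinfun_apply S e) \<le> norm n + 1/2 * norm e"
      using norm_triangle_ineq[of n "\<mu> *\<^sub>C cblinfun_apply S e"] half[OF \<mu>, of e] by linarith
    then have "norm e \<le> norm n + 1/2 * norm e" using e by simp
    then show ?thesis by linarith
  qed
  have "vanalytic_on (\<lambda>\<mu>. R \<mu> n) (ball 0 \<delta>)" for n
    unfolding vanalytic_on_def
  proof
    fix \<nu> :: complex assume \<nu>: "\<nu> \<in> ball 0 \<delta>"
    \<comment> \<open>The candidate derivative, from differentiating \<open>R \<mu> n = n + \<mu> S (R \<mu> n)\<close> formally.\<close>
    define d where "d = R \<nu> (cblinfun_apply S (R \<nu> n))"
    have d: "d = cblinfun_apply S (R \<nu> n) + \<nu> *\<^sub>C cblinfun_apply S d"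
      unfolding d_def by (rule R[OF \<nu>])
    have est: "norm (R \<mu> n - R \<nu> n - (\<mu> - \<nu>) *\<^sub>C d) \<le> 2 * (cmod (\<mu> - \<nu>) ^ 2 * norm (cblinfun_apply S d))"
      if \<mu>: "\<mu> \<in> ball 0 \<delta>" for \<mu>
    proof -
      define t where "t = \<mu> - \<nu>"
      have mu_eq: "\<mu> = \<nu> + t" by (simp add: t_def)
      define e where "e = R \<mu> n - R \<nu> n - t *\<^sub>C d"
      have Rmu: "R \<mu> n = R \<nu> n + t *\<^sub>C d + e" by (simp add: e_def)
      have "e = (n + \<mu> *\<^sub>C cblinfun_apply S (R \<mu> n)) - (n + \<nu> *\<^sub>C cblinfun_apply S (R \<nu> n))
          - t *\<^sub>C (cblinfun_apply S (R \<nu> n) + \<nu> *\<^sub>C cblinfun_apply S d)"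
        unfolding e_def using R[OF \<mu>, of n] R[OF \<nu>, of n] d by metis
      also have "\<dots> = t ^ 2 *\<^sub>C cblinfun_apply S d + \<mu> *\<^sub>C cblinfun_apply S e"
        unfolding Rmu unfolding mu_eq
        by (simp add: cblinfun_linear cblinfun_scaleC scaleC_scaleC scaleC_add_right scaleC_add_left
            power2_eq_square algebra_simps)
      finally have "norm e \<le> 2 * norm (t ^ 2 *\<^sub>C cblinfun_apply S d)" by (rule bound[OF \<mu>])
      then show ?thesis by (simp add: e_def t_def norm_scaleC norm_power)
    qed
    obtain \<epsilon> where \<epsilon>: "\<epsilon> > 0" "ball \<nu> \<epsilon> \<subseteq> ball 0 \<delta>"
      using \<nu> open_contains_ball_eq[OF open_ball] by blast
    have "((\<lambda>\<mu>. R \<mu> n) has_derivative (\<lambda>h. h *\<^sub>C d)) (at \<nu>)"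
    proof (rule has_derivativeI_sandwich[OF \<epsilon>(1)])
      show "bounded_linear (\<lambda>h::complex. h *\<^sub>C d)"
        by (rule bounded_linear_intro[where K = "norm d"])
          (simp_all add: scaleC_add_left scaleR_scaleC scaleC_scaleC norm_scaleC scaleC_complex_def)
      show "norm (R \<mu> n - R \<nu> n - (\<mu> - \<nu>) *\<^sub>C d) / norm (\<mu> - \<nu>) \<le> 2 * (cmod (\<mu> - \<nu>) * norm (cblinfun_apply S d))"
        if "\<mu> \<in> UNIV" "\<mu> \<noteq> \<nu>" "dist \<mu> \<nu> < \<epsilon>" for \<mu>
      proof -
        have "\<mu> \<in> ball 0 \<delta>" using that(3) by (intro subsetD[OF \<epsilon>(2)]) (simp add: dist_commute)
        from est[OF this] show ?thesis using that by (simp add: field_simps power2_eq_square)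
      qed
      have "((\<lambda>\<mu>. 2 * (cmod (\<mu> - \<nu>) * norm (cblinfun_apply S d))) \<longlongrightarrow> 2 * (cmod (\<nu> - \<nu>) * norm (cblinfun_apply S d))) (at \<nu>)"
        by (intro tendsto_intros)
      then show "((\<lambda>\<mu>. 2 * (cmod (\<mu> - \<nu>) * norm (cblinfun_apply S d))) \<longlongrightarrow> 0) (at \<nu>)" by simp
    qed
    then show "\<exists>d. ((\<lambda>\<mu>. R \<mu> n) has_derivative (\<lambda>h. h *\<^sub>C d)) (at \<nu>)" by blast
  qed
  then show ?thesis using \<delta> R by (intro exI[of _ R] exI[of _ \<delta>]) simp
qed

text \<open>For a null vector \<open>b\<close> the family \<open>x(\<mu>) = (I - \<mu>S)\<^sup>-\<^sup>1 b\<close> satisfies \<open>T x(\<mu>) = \<mu> T S x(\<mu>)\<close>, hence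
\<open>(T - \<mu>) x(\<mu>)\<close> is \<open>-\<mu>\<close> times the sum of the \<open>\<phi>\<^sub>i(x(\<mu>)) z\<^sub>i\<close>. If there are more vectors \<open>b\<close> than indices \<open>i\<close>,
some combination of the families with holomorphic coefficients is annihilated by all the \<open>\<phi>\<^sub>i\<close> and
consists of eigenvectors. It does not vanish, because \<open>I - \<mu>S\<close> maps it to the same combination of
the independent vectors \<open>b\<close>.\<close>

lemma SVEP_imp_nullity_bound:
  fixes T S :: "'a::cbanach \<Rightarrow>\<^sub>C\<^sub>L 'a" and \<phi> :: "'i \<Rightarrow> 'a cdual"
  assumes svep: "SVEP_at T 0" and I: "finite I"
    and TS: "\<And>y. y - cblinfun_apply T (cblinfun_apply S y) = (\<Sum>i\<in>I. cblinfun_apply (\<phi> i) y *\<^sub>C z i)"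
    and B: "finite B" "\<not> cdependent B" "B \<subseteq> null_space T"
  shows "card B \<le> card I"
proof (rule ccontr)
  assume "\<not> card B \<le> card I"
  then have card: "card I < card B" by simp
  obtain r where r: "r > 0" and uniq: "\<And>V f \<mu>. open V \<Longrightarrow> V \<subseteq> ball 0 r \<Longrightarrow> vanalytic_on f V \<Longrightarrow>
      (\<forall>\<mu>\<in>V. cblinfun_apply (T - \<mu> *\<^sub>C cid) (f \<mu>) = 0) \<Longrightarrow> \<mu> \<in> V \<Longrightarrow> f \<mu> = 0"
    using svep unfolding SVEP_at_def by metis
  obtain R :: "complex \<Rightarrow> 'a \<Rightarrow> 'a" and \<delta> where \<delta>: "\<delta> > 0"
    and R: "\<forall>\<mu>\<in>ball 0 \<delta>. \<forall>n. R \<mu> n = n + \<mu> *\<^sub>C cblinfun_apply S (R \<mu> n)"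
    and R_an: "\<forall>n. vanalytic_on (\<lambda>\<mu>. R \<mu> n) (ball 0 \<delta>)"
    using analytic_resolvent[of S] by (elim exE conjE) (rule that)
  define U where "U = ball (0::complex) (min r \<delta>)"
  have U: "open U" "U \<noteq> {}" "U \<subseteq> ball 0 r" "U \<subseteq> ball 0 \<delta>" using r \<delta> by (auto simp: U_def)
  have "(\<lambda>\<mu>. cblinfun_apply (\<phi> i) (R \<mu> b)) holomorphic_on U" for i b
    using holomorphic_on_functional[OF R_an[rule_format] open_ball] U(4) by (rule holomorphic_on_subset)
  then obtain V c where V: "open V" "V \<noteq> {}" "V \<subseteq> U" "\<forall>b\<in>B. c b holomorphic_on V"
    and c_kernel: "\<forall>i\<in>I. \<forall>\<mu>\<in>V. (\<Sum>b\<in>B. c b \<mu> * cblinfun_apply (\<phi> i) (R \<mu> b)) = 0"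
    and c_one: "\<exists>b\<in>B. \<forall>\<mu>\<in>V. c b \<mu> = 1"
    using holomorphic_nontrivial_kernel[OF I B(1) card U(1,2), of "\<lambda>i b \<mu>. cblinfun_apply (\<phi> i) (R \<mu> b)"]
    by blast
  define f where "f \<mu> = (\<Sum>b\<in>B. c b \<mu> *\<^sub>C R \<mu> b)" for \<mu>
  have f_eq: "f \<mu> = (\<Sum>b\<in>B. c b \<mu> *\<^sub>C b) + \<mu> *\<^sub>C cblinfun_apply S (f \<mu>)" if "\<mu> \<in> V" for \<mu>
  proof -
    have \<mu>: "\<mu> \<in> ball 0 \<delta>" using that V(3) U(4) by blast
    have "f \<mu> = (\<Sum>b\<in>B. c b \<mu> *\<^sub>C (b + \<mu> *\<^sub>C cblinfun_apply S (R \<mu> b)))"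
      unfolding f_def using R \<mu> by metis
    also have "\<dots> = (\<Sum>b\<in>B. c b \<mu> *\<^sub>C b) + \<mu> *\<^sub>C cblinfun_apply S (f \<mu>)"
      by (simp add: f_def cblinfun_linear cblinfun_scaleC scaleC_add_right sum.distrib scaleC_scaleC
          complex_vector.scale_sum_right mult.commute)
    finally show ?thesis .
  qed
  have eigen: "cblinfun_apply (T - \<mu> *\<^sub>C cid) (f \<mu>) = 0" if \<mu>: "\<mu> \<in> V" for \<mu>
  proof -
    have "cblinfun_apply (\<phi> i) (f \<mu>) = 0" if "i \<in> I" for i
      using c_kernel that \<mu> by (simp add: f_def cblinfun_linear cblinfun_scaleC scaleC_complex_def)
    then have TSf: "cblinfun_apply T (cblinfun_apply S (f \<mu>)) = f \<mu>"
      using TS[of "f \<mu>"] by simp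
    have "cblinfun_apply T (\<Sum>b\<in>B. c b \<mu> *\<^sub>C b) = 0"
      using B(3) by (auto simp: cblinfun_linear cblinfun_scaleC null_space_def intro!: sum.neutral)
    moreover have "cblinfun_apply T (f \<mu>) = cblinfun_apply T ((\<Sum>b\<in>B. c b \<mu> *\<^sub>C b) + \<mu> *\<^sub>C cblinfun_apply S (f \<mu>))"
      using f_eq[OF \<mu>] by (rule arg_cong)
    ultimately have "cblinfun_apply T (f \<mu>) = \<mu> *\<^sub>C f \<mu>"
      using TSf by (simp only: cblinfun_linear(1) cblinfun_scaleC add_0_left)
    then show ?thesis by (simp add: cblinfun_apply_simps cid_apply)
  qed
  have f_an: "vanalytic_on f V"
    unfolding f_def
  proof (intro vanalytic_on_sum vanalytic_on_scaleC V(1))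
    show "c b holomorphic_on V" if "b \<in> B" for b using that V(4) by blast
    show "vanalytic_on (\<lambda>\<mu>. R \<mu> b) V" for b
      using R_an[rule_format, of b] V(3) U(4) unfolding vanalytic_on_def by blast
  qed
  obtain \<mu> where \<mu>: "\<mu> \<in> V" using V(2) by blast
  have "f \<mu> = 0"
    using uniq[OF V(1) _ f_an _ \<mu>] V(3) U(3) eigen by blast
  then have "(\<Sum>b\<in>B. c b \<mu> *\<^sub>C b) = 0" using f_eq[OF \<mu>] by (simp add: cblinfun_linear)
  then have "c b \<mu> = 0" if "b \<in> B" for b
    using complex_vector.independentD[OF B(2,1) subset_refl, of "\<lambda>b. c b \<mu>"] that by blast
  then show False using c_one \<mu> by auto
qed

text \<open>With a generalized inverse \<open>S\<close>, the operator \<open>I - T S\<close> has its range in a complement of the range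
of \<open>T\<close>, so its rank is at most the deficiency.\<close>

lemma SVEP_imp_nullity_le_deficiency:
  fixes T :: "'a::cbanach \<Rightarrow>\<^sub>C\<^sub>L 'a"
  assumes T: "T \<in> left_semi_Fredholm" and svep: "SVEP_at T 0"
  shows "nullity T \<le> deficiency T"
proof -
  have fin: "nullity T < \<infinity>" using T by (simp add: left_semi_Fredholm_def)
  obtain Z where Z: "csubspace Z" "closed Z" "range (cblinfun_apply T) \<inter> Z = {0}"
      "subspace_sum (range (cblinfun_apply T)) Z = UNIV"
    using T unfolding left_semi_Fredholm_def closed_complemented_def by blast
  obtain S where S: "\<forall>y. y - cblinfun_apply T (cblinfun_apply S y) \<in> Z"
    using generalized_inverse[OF fin Z] by blast
  have def: "deficiency T = cedim Z"
    unfolding deficiency_def by (rule cecodim_eq_cedim_complement[OF csubspace_range Z(1,3,4)])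
  show ?thesis
  proof (cases rule: cedim_cases[OF Z(1)])
    case 2
    then show ?thesis by (simp add: def)
  next
    case (1 BZ)
    define Q where "Q = cid - ccompose T S"
    have Q: "cblinfun_apply Q y = y - cblinfun_apply T (cblinfun_apply S y)" for y
      by (simp add: Q_def cblinfun_apply_simps cid_apply ccompose_apply)
    have "cblinfun_apply Q y \<in> cspan BZ" for y using S 1(3) by (simp add: Q)
    then obtain \<psi> :: "'a \<Rightarrow> 'a cdual" where \<psi>: "\<forall>y. cblinfun_apply Q y = (\<Sum>b\<in>BZ. cblinfun_apply (\<psi> b) y *\<^sub>C b)"
      using finite_rank_expansion[OF 1(1,2), of Q] by blast
    show ?thesis
    proof (cases rule: cedim_cases[OF csubspace_null_space[of T]])
      case B: (1 B)
      have "card B \<le> card BZ"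
      proof (rule SVEP_imp_nullity_bound[OF svep 1(1)])
        show "y - cblinfun_apply T (cblinfun_apply S y) = (\<Sum>b\<in>BZ. cblinfun_apply (\<psi> b) y *\<^sub>C b)" for y
          using \<psi> by (simp add: Q)
        show "B \<subseteq> null_space T" using B(3) complex_vector.span_superset by blast
      qed (use B in auto)
      then show ?thesis using B 1 by (simp add: def nullity_def)
    next
      case 2
      then show ?thesis using fin by (simp add: nullity_def)
    qed
  qed
qed

definition evaluation :: "'a::complex_normed_vector \<Rightarrow> 'a cdual cdual"
  where "evaluation x = mk_cblinfun (\<lambda>f. cblinfun_apply f x)"

lemma evaluation_apply: "cblinfun_apply (evaluation x) f = cblinfun_apply f x"
  unfolding evaluation_def
proof (rule mk_cblinfun_apply)
  show "bounded_linear (\<lambda>f :: 'a cdual. cblinfun_apply f x)"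
    by (rule bounded_linear_intro[where K = "norm x"])
      (simp_all add: cblinfun_apply_simps scaleR_scaleC norm_cblinfun_apply)
qed (simp add: cblinfun_apply_simps)

lemma large_cedim_imp_independent_subset:
  assumes Z: "csubspace Z" and n: "\<not> cedim Z \<le> enat n"
  obtains B where "finite B" "\<not> cdependent B" "B \<subseteq> Z" "n < card B"
proof -
  obtain b where b: "b \<subseteq> Z" "\<not> cdependent b" "Z \<subseteq> cspan b"
    using complex_vector.maximal_independent_subset by blast
  have sb: "cspan b = Z" using b complex_vector.span_minimal[OF b(1) Z] by blast
  show thesis
  proof (cases "finite b")
    case True
    then have "cedim Z = enat (card b)" using cedim_cspan[OF True b(2)] sb by simp
    then show thesis using n that[OF True b(2,1)] by simp
  next
    case False
    then obtain B where "B \<subseteq> b" "finite B" "card B = Suc n"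
      using infinite_arbitrarily_large by blast
    then show thesis
      using b(1) complex_vector.independent_mono[OF b(2)] by (intro that[of B]) auto
  qed
qed

text \<open>Elimination with constant coefficients: a nontrivial combination of too many
independent vectors would be annihilated by all functionals in \<open>L\<close>.\<close>

lemma cedim_le_card_separating:
  fixes L :: "'a::complex_normed_vector cdual set"
  assumes Z: "csubspace Z" and L: "finite L"
    and sep: "\<And>x. x \<in> Z \<Longrightarrow> (\<forall>f\<in>L. cblinfun_apply f x = 0) \<Longrightarrow> x = 0"
  shows "cedim Z \<le> enat (card L)"
proof (rule ccontr)
  assume "\<not> cedim Z \<le> enat (card L)"
  then obtain B where B: "finite B" "\<not> cdependent B" "B \<subseteq> Z" "card L < card B"
    by (rule large_cedim_imp_independent_subset[OF Z])
  obtain V c where "open V" and V: "V \<noteq> {}" and "V \<subseteq> UNIV" "\<forall>b\<in>B. c b holomorphic_on V"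
    and c: "\<forall>f\<in>L. \<forall>z\<in>V. (\<Sum>b\<in>B. c b z * cblinfun_apply f b) = 0"
    and c_one: "\<exists>b\<in>B. \<forall>z\<in>V. c b z = 1"
    using holomorphic_nontrivial_kernel[OF L B(1,4) open_UNIV UNIV_not_empty, of "\<lambda>f b _. cblinfun_apply f b", OF holomorphic_on_const]
    by (elim exE conjE) (rule that)
  obtain z where z: "z \<in> V" using V by blast
  have "(\<Sum>b\<in>B. c b z *\<^sub>C b) = 0"
  proof (rule sep)
    show "(\<Sum>b\<in>B. c b z *\<^sub>C b) \<in> Z"
      using B(3) by (intro complex_vector.subspace_sum[OF Z] complex_vector.subspace_scale[OF Z]) blast
    show "\<forall>f\<in>L. cblinfun_apply f (\<Sum>b\<in>B. c b z *\<^sub>C b) = 0"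
      using c z by (simp add: cblinfun_linear cblinfun_scaleC scaleC_complex_def)
  qed
  then have "c b z = 0" if "b \<in> B" for b
    using complex_vector.independentD[OF B(2,1) subset_refl, of "\<lambda>b. c b z"] that by blast
  then show False using c_one z by auto
qed

text \<open>The null space of the dual operator consists of the functionals that vanish on the range. By
Hahn-Banach these separate the points of a complement of a closed range.\<close>

lemma deficiency_le_card_annihilator_span:
  fixes T :: "'a::complex_normed_vector \<Rightarrow>\<^sub>C\<^sub>L 'b::complex_normed_vector"
  assumes closed: "closed (range (cblinfun_apply T))"
    and L: "finite L" "null_space (dual_op T) \<subseteq> cspan L"
  shows "deficiency T \<le> enat (card L)"
proof -
  obtain Z where Z: "csubspace Z" "range (cblinfun_apply T) \<inter> Z = {0}"
      "subspace_sum (range (cblinfun_apply T)) Z = UNIV"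
    using csubspace_complement_exists[OF csubspace_range[of T] complex_vector.subspace_UNIV subset_UNIV]
    by (elim exE conjE) (rule that)
  have "cedim Z \<le> enat (card L)"
  proof (rule cedim_le_card_separating[OF Z(1) L(1)])
    fix x assume x: "x \<in> Z" "\<forall>f\<in>L. cblinfun_apply f x = 0"
    show "x = 0"
    proof (rule ccontr)
      assume "x \<noteq> 0"
      then have "x \<notin> range (cblinfun_apply T)" using x(1) Z(2) by blast
      then obtain f :: "'b cdual" where f: "\<forall>m\<in>range (cblinfun_apply T). cblinfun_apply f m = 0" "cblinfun_apply f x = 1"
        using separating_functional[OF csubspace_range closed] by blast
      have "f \<in> null_space (dual_op T)"
        unfolding null_space_def mem_Collect_eq
        by (rule cblinfun_eqI) (use f(1) in \<open>simp add: dual_op_apply cblinfun_apply_simps\<close>)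
      moreover have "cspan L \<subseteq> {g. cblinfun_apply (evaluation x) g \<in> {0}}"
        using x(2) by (intro complex_vector.span_minimal csubspace_preimage complex_vector.subspace_single_0)
          (auto simp: evaluation_apply)
      ultimately have "cblinfun_apply f x = 0" using L(2) by (auto simp: evaluation_apply)
      then show False using f(2) by simp
    qed
  qed
  then show ?thesis
    unfolding deficiency_def cecodim_eq_cedim_complement[OF csubspace_range Z] .
qed

text \<open>The dual of a generalized inverse \<open>S\<close> of \<open>T\<close> is one of \<open>T\<^sup>*\<close>: the operator \<open>I - T\<^sup>* S\<^sup>*\<close> is the dual of
the projection \<open>I - S T\<close> onto the null space of \<open>T\<close>, and its rank is at most the nullity of \<open>T\<close>. So
the nullity of \<open>T\<^sup>*\<close>, and with it the deficiency of \<open>T\<close>, is bounded by the nullity of \<open>T\<close>.\<close>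

lemma dual_SVEP_imp_deficiency_le_nullity:
  fixes T :: "'a::cbanach \<Rightarrow>\<^sub>C\<^sub>L 'a"
  assumes T: "T \<in> left_semi_Fredholm" and svep: "SVEP_at (dual_op T) 0"
  shows "deficiency T \<le> nullity T"
proof -
  have fin: "nullity T < \<infinity>" using T by (simp add: left_semi_Fredholm_def)
  obtain Z where Z: "closed (range (cblinfun_apply T))" "csubspace Z" "closed Z" "range (cblinfun_apply T) \<inter> Z = {0}"
      "subspace_sum (range (cblinfun_apply T)) Z = UNIV"
    using T unfolding left_semi_Fredholm_def closed_complemented_def by blast
  obtain S where S: "\<forall>x. x - cblinfun_apply S (cblinfun_apply T x) \<in> null_space T"
    using generalized_inverse[OF fin Z(2-)] by blast
  show ?thesis
  proof (cases rule: cedim_cases[OF csubspace_null_space[of T]])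
    case 2
    then show ?thesis using fin by (simp add: nullity_def)
  next
    case (1 B)
    define P where "P = cid - ccompose S T"
    have P: "cblinfun_apply P x = x - cblinfun_apply S (cblinfun_apply T x)" for x
      by (simp add: P_def cblinfun_apply_simps cid_apply ccompose_apply)
    have "cblinfun_apply P y \<in> cspan B" for y using S 1(3) by (simp add: P)
    then obtain \<psi> :: "'a \<Rightarrow> 'a cdual" where \<psi>: "\<forall>x. cblinfun_apply P x = (\<Sum>b\<in>B. cblinfun_apply (\<psi> b) x *\<^sub>C b)"
      using finite_rank_expansion[OF 1(1,2), of P] by blast
    have dual: "f - cblinfun_apply (dual_op T) (cblinfun_apply (dual_op S) f)
        = (\<Sum>b\<in>B. cblinfun_apply (evaluation b) f *\<^sub>C \<psi> b)" for f
    proof (rule cblinfun_eqI)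
      fix x
      have "cblinfun_apply (f - cblinfun_apply (dual_op T) (cblinfun_apply (dual_op S) f)) x = cblinfun_apply f (cblinfun_apply P x)"
        by (simp add: cblinfun_apply_simps dual_op_apply P cblinfun_linear)
      also have "\<dots> = (\<Sum>b\<in>B. cblinfun_apply (\<psi> b) x *\<^sub>C cblinfun_apply f b)"
        by (simp add: \<psi> cblinfun_linear cblinfun_scaleC)
      also have "\<dots> = (\<Sum>b\<in>B. cblinfun_apply (evaluation x) (cblinfun_apply (evaluation b) f *\<^sub>C \<psi> b))"
        by (simp add: evaluation_apply cblinfun_apply_simps scaleC_complex_def mult.commute)
      also have "\<dots> = cblinfun_apply (evaluation x) (\<Sum>b\<in>B. cblinfun_apply (evaluation b) f *\<^sub>C \<psi> b)"
        by (simp only: cblinfun_linear(5))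
      also have "\<dots> = cblinfun_apply (\<Sum>b\<in>B. cblinfun_apply (evaluation b) f *\<^sub>C \<psi> b) x"
        by (rule evaluation_apply)
      finally show "cblinfun_apply (f - cblinfun_apply (dual_op T) (cblinfun_apply (dual_op S) f)) x
        = cblinfun_apply (\<Sum>b\<in>B. cblinfun_apply (evaluation b) f *\<^sub>C \<psi> b) x" .
    qed
    have bound: "card L \<le> card B" if "finite L" "\<not> cdependent L" "L \<subseteq> null_space (dual_op T)" for L
      using SVEP_imp_nullity_bound[OF svep 1(1) dual that] .
    have "cedim (null_space (dual_op T)) \<le> enat (card B)"
    proof (rule ccontr)
      assume "\<not> ?thesis"
      then obtain L where "finite L" "\<not> cdependent L" "L \<subseteq> null_space (dual_op T)" "card B < card L"
        by (rule large_cedim_imp_independent_subset[OF csubspace_null_space])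
      then show False using bound[of L] by simp
    qed
    then obtain L where "finite L" "cspan L = null_space (dual_op T)" "card L \<le> card B"
      by (cases rule: cedim_cases[OF csubspace_null_space[of "dual_op T"]]) auto
    then have "deficiency T \<le> enat (card L)" "card L \<le> card B"
      using deficiency_le_card_annihilator_span[OF Z(1)] by auto
    then show ?thesis using 1 by (simp add: nullity_def) (meson enat_ord_simps(1) order_trans)
  qed
qed


section \<open>Triangular operators\<close>

text \<open>This keeps the later arithmetic in the extended naturals, away from differences of extended reals.\<close>

lemma left_semi_Weyl_iff:
  "T \<in> left_semi_Weyl \<longleftrightarrow> T \<in> left_semi_Fredholm \<and> nullity T \<le> deficiency T"
proof -
  have "ind T \<le> 0 \<longleftrightarrow> nullity T \<le> deficiency T" if "nullity T < \<infinity>"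
    using that unfolding ind_def by (cases "nullity T"; cases "deficiency T") (auto simp: zero_ereal_def)
  then show ?thesis by (auto simp: left_semi_Weyl_def left_semi_Fredholm_def)
qed

lemma clinear_in_cspan_image:
  assumes "clinear f" "x \<in> cspan K"
  shows "f x \<in> cspan (f ` K)"
proof -
  interpret f: Vector_Spaces.linear scaleC scaleC f by fact
  show ?thesis using assms(2) f.span_image[of K] by (simp add: cspan_raw_def)
qed

text \<open>The parametrix is the formal inverse of the triangular matrix, with parametrices \<open>SA\<close> and \<open>SB\<close> in
place of the inverses: its upper right entry is \<open>- SA C SB\<close>. What it misses of \<open>p\<close> is the error at
\<open>x\<close> together with the image under \<open>g\<close> of the error at \<open>y\<close>.\<close>

lemma upper_triangular_left_semi_Fredholm:
  fixes A :: "'x::cbanach \<Rightarrow>\<^sub>C\<^sub>L 'x" and B :: "'y::cbanach \<Rightarrow>\<^sub>C\<^sub>L 'y"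
  assumes A: "A \<in> left_semi_Fredholm" and B: "B \<in> left_semi_Fredholm"
  shows "upper_triangular A C B \<in> left_semi_Fredholm"
proof -
  obtain SA KA where SA: "finite KA" "\<And>x. x - cblinfun_apply SA (cblinfun_apply A x) \<in> cspan KA"
    using A unfolding left_semi_Fredholm_iff_left_parametrix by blast
  obtain SB KB where SB: "finite KB" "\<And>y. y - cblinfun_apply SB (cblinfun_apply B y) \<in> cspan KB"
    using B unfolding left_semi_Fredholm_iff_left_parametrix by blast
  define S where "S = upper_triangular SA (- ccompose SA (ccompose C SB)) SB"
  define g where "g v = (- cblinfun_apply SA (cblinfun_apply C v), v)" for v
  have g: "clinear g"
    by (rule clinearI) (simp_all add: g_def cblinfun_linear cblinfun_scaleC scaleC_prod_def
        complex_vector.scale_minus_right)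
  let ?K = "(\<lambda>x. (x, 0)) ` KA \<union> g ` KB"
  have "p - cblinfun_apply S (cblinfun_apply (upper_triangular A C B) p) \<in> cspan ?K" for p
  proof -
    obtain x y where p: "p = (x, y)" by (cases p)
    let ?a = "x - cblinfun_apply SA (cblinfun_apply A x)"
    let ?b = "y - cblinfun_apply SB (cblinfun_apply B y)"
    have "p - cblinfun_apply S (cblinfun_apply (upper_triangular A C B) p) = (?a, 0) + g ?b"
      by (simp add: p S_def g_def upper_triangular_apply cblinfun_apply_simps ccompose_apply cblinfun_linear)
    moreover have "(?a, 0) \<in> cspan ?K"
      using clinear_in_cspan_image[OF clinear_Pair_left SA(2)] complex_vector.span_mono[of _ ?K] by blast
    moreover have "g ?b \<in> cspan ?K"
      using clinear_in_cspan_image[OF g SB(2)] complex_vector.span_mono[of _ ?K] by blast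
    ultimately show ?thesis by (simp add: complex_vector.span_add)
  qed
  moreover have "finite ?K" using SA SB by simp
  ultimately show ?thesis by (metis left_parametrix_imp_left_semi_Fredholm)
qed

lemma upper_triangular_left_semi_Fredholm_imp_first:
  fixes A :: "'x::cbanach \<Rightarrow>\<^sub>C\<^sub>L 'x" and B :: "'y::cbanach \<Rightarrow>\<^sub>C\<^sub>L 'y"
  assumes M: "upper_triangular A C B \<in> left_semi_Fredholm"
  shows "A \<in> left_semi_Fredholm"
proof -
  obtain S K where S: "finite K" "\<And>p. p - cblinfun_apply S (cblinfun_apply (upper_triangular A C B) p) \<in> cspan K"
    using M unfolding left_semi_Fredholm_iff_left_parametrix by blast
  define S1 where "S1 = mk_cblinfun (\<lambda>x. fst (cblinfun_apply S (x, 0)))"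
  have S1: "cblinfun_apply S1 x = fst (cblinfun_apply S (x, 0))" for x
    unfolding S1_def
  proof (rule mk_cblinfun_apply)
    show "bounded_linear (\<lambda>x. fst (cblinfun_apply S (x, 0)))"
      by (intro bounded_linear_compose[OF bounded_linear_fst] bounded_linear_compose[OF bounded_linear_cblinfun]
          bounded_linear_Pair bounded_linear_ident bounded_linear_zero)
    show "fst (cblinfun_apply S (c *\<^sub>C x, 0)) = c *\<^sub>C fst (cblinfun_apply S (x, 0))" for c x
      using cblinfun_scaleC[of S c "(x, 0)"] by (simp add: scaleC_prod_def)
  qed
  have fst: "clinear fst" by (rule clinearI) (simp_all add: scaleC_prod_def)
  have "x - cblinfun_apply S1 (cblinfun_apply A x) \<in> cspan (fst ` K)" for x
    using clinear_in_cspan_image[OF fst S(2)[of "(x, 0)"]]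
    by (simp add: S1 upper_triangular_apply cblinfun_linear)
  then show ?thesis using left_parametrix_imp_left_semi_Fredholm S(1) by (metis finite_imageI)
qed

text \<open>Given \<open>y\<close>, a right parametrix of \<open>A\<close> provides an \<open>x\<close> for which \<open>q = A x + C y\<close> lies in a
finite-dimensional space. The triangular operator then sends \<open>(x, y)\<close> to \<open>(q, B y)\<close>, from which its
parametrix recovers \<open>y\<close> up to an error of finite rank.\<close>

lemma upper_triangular_left_semi_Fredholm_imp_second:
  fixes A :: "'x::cbanach \<Rightarrow>\<^sub>C\<^sub>L 'x" and B :: "'y::cbanach \<Rightarrow>\<^sub>C\<^sub>L 'y"
  assumes M: "upper_triangular A C B \<in> left_semi_Fredholm"
    and A: "A \<in> left_semi_Fredholm" "deficiency A < \<infinity>"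
  shows "B \<in> left_semi_Fredholm"
proof -
  obtain S K where S: "finite K" "\<And>p. p - cblinfun_apply S (cblinfun_apply (upper_triangular A C B) p) \<in> cspan K"
    using M unfolding left_semi_Fredholm_iff_left_parametrix by blast
  have fin: "nullity A < \<infinity>" using A by (simp add: left_semi_Fredholm_def)
  obtain Z where Z: "csubspace Z" "closed Z" "range (cblinfun_apply A) \<inter> Z = {0}"
      "subspace_sum (range (cblinfun_apply A)) Z = UNIV"
    using A(1) unfolding left_semi_Fredholm_def closed_complemented_def by blast
  have "cedim Z < \<infinity>"
    using A(2) cecodim_eq_cedim_complement[OF csubspace_range Z(1,3,4)] by (simp add: deficiency_def)
  then obtain KZ where KZ: "finite KZ" "cspan KZ = Z"
    by (cases rule: cedim_cases[OF Z(1)]) auto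
  obtain A' where A': "\<forall>x. x - cblinfun_apply A (cblinfun_apply A' x) \<in> Z"
    using generalized_inverse[OF fin Z] by blast
  define S2 where "S2 = mk_cblinfun (\<lambda>y. snd (cblinfun_apply S (0, y)))"
  have S2: "cblinfun_apply S2 y = snd (cblinfun_apply S (0, y))" for y
    unfolding S2_def
  proof (rule mk_cblinfun_apply)
    show "bounded_linear (\<lambda>y. snd (cblinfun_apply S (0, y)))"
      by (intro bounded_linear_compose[OF bounded_linear_snd] bounded_linear_compose[OF bounded_linear_cblinfun]
          bounded_linear_Pair bounded_linear_ident bounded_linear_zero)
    show "snd (cblinfun_apply S (0, c *\<^sub>C y)) = c *\<^sub>C snd (cblinfun_apply S (0, y))" for c y
      using cblinfun_scaleC[of S c "(0, y)"] by (simp add: scaleC_prod_def)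
  qed
  define h where "h x = snd (cblinfun_apply S (x, 0))" for x
  have h: "clinear h"
  proof (rule clinearI)
    show "h (x + x') = h x + h x'" for x x'
      using cblinfun_linear(1)[of S "(x, 0)" "(x', 0)"] by (simp add: h_def)
    show "h (c *\<^sub>C x) = c *\<^sub>C h x" for c x
      using cblinfun_scaleC[of S c "(x, 0)"] by (simp add: scaleC_prod_def h_def)
  qed
  let ?K = "snd ` K \<union> h ` KZ"
  have "y - cblinfun_apply S2 (cblinfun_apply B y) \<in> cspan ?K" for y
  proof -
    define x where "x = - cblinfun_apply A' (cblinfun_apply C y)"
    define q where "q = cblinfun_apply A x + cblinfun_apply C y"
    have "q \<in> cspan KZ"
      using A'[rule_format, of "cblinfun_apply C y"] KZ by (simp add: q_def x_def cblinfun_linear)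
    from clinear_in_cspan_image[OF h this] have hq: "h q \<in> cspan ?K"
      using complex_vector.span_mono[of _ ?K] by blast
    have "snd ((x, y) - cblinfun_apply S (q, cblinfun_apply B y)) \<in> cspan (snd ` K)"
      using clinear_in_cspan_image[OF clinear_snd S(2)[of "(x, y)"]] by (simp add: upper_triangular_apply q_def)
    moreover have "snd (cblinfun_apply S (q, cblinfun_apply B y)) = h q + cblinfun_apply S2 (cblinfun_apply B y)"
      using cblinfun_linear(1)[of S "(q, 0)" "(0, cblinfun_apply B y)"] by (simp add: h_def S2)
    ultimately have "y - (h q + cblinfun_apply S2 (cblinfun_apply B y)) \<in> cspan ?K"
      using complex_vector.span_mono[of "snd ` K" ?K] by auto
    from complex_vector.span_add[OF this hq] show ?thesis by simp
  qed
  moreover have "finite ?K" using S(1) KZ(1) by simp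
  ultimately show ?thesis by (metis left_parametrix_imp_left_semi_Fredholm)
qed

lemma upper_triangular_left_semi_Weyl:
  fixes A :: "'x::cbanach \<Rightarrow>\<^sub>C\<^sub>L 'x" and B :: "'y::cbanach \<Rightarrow>\<^sub>C\<^sub>L 'y"
  assumes "A \<in> left_semi_Weyl" "B \<in> left_semi_Weyl"
  shows "upper_triangular A C B \<in> left_semi_Weyl"
proof -
  let ?M = "upper_triangular A C B"
  have A: "A \<in> left_semi_Fredholm" "nullity A \<le> deficiency A"
    and B: "B \<in> left_semi_Fredholm" "nullity B \<le> deficiency B"
    using assms by (auto simp: left_semi_Weyl_iff)
  obtain k where k: "k \<le> nullity B" "nullity ?M + k = nullity A + nullity B"
    "deficiency ?M + k = deficiency A + deficiency B"
    using upper_triangular_nullity_deficiency[of B A C] by blast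
  have "nullity B < \<infinity>" using B(1) by (simp add: left_semi_Fredholm_def)
  with k(1) have "k < \<infinity>" by (rule le_less_trans)
  moreover have "nullity ?M + k \<le> deficiency ?M + k"
    unfolding k using A(2) B(2) by (rule add_mono)
  ultimately have "nullity ?M \<le> deficiency ?M"
    by (cases k; cases "nullity ?M"; cases "deficiency ?M") auto
  then show ?thesis
    using upper_triangular_left_semi_Fredholm[OF A(1) B(1)] by (simp add: left_semi_Weyl_iff)
qed

text \<open>In terms of indices: \<open>ind A + ind B \<le> 0\<close> and \<open>ind A \<ge> 0\<close>; moreover \<open>ind A \<le> 0\<close> or \<open>ind B \<ge> 0\<close>. Either
way both indices are nonpositive.\<close>

lemma upper_triangular_left_semi_Weyl_converse:
  fixes A :: "'x::cbanach \<Rightarrow>\<^sub>C\<^sub>L 'x" and B :: "'y::cbanach \<Rightarrow>\<^sub>C\<^sub>L 'y"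
  assumes M: "upper_triangular A C B \<in> left_semi_Weyl"
    and svep_dual_A: "SVEP_at (dual_op A) 0"
    and svep: "SVEP_at A 0 \<or> SVEP_at (dual_op B) 0"
  shows "A \<in> left_semi_Weyl \<and> B \<in> left_semi_Weyl"
proof -
  let ?M = "upper_triangular A C B"
  have MF: "?M \<in> left_semi_Fredholm" "nullity ?M \<le> deficiency ?M"
    using M by (auto simp: left_semi_Weyl_iff)
  have A: "A \<in> left_semi_Fredholm"
    using MF(1) by (rule upper_triangular_left_semi_Fredholm_imp_first)
  have dA: "deficiency A \<le> nullity A"
    using A svep_dual_A by (rule dual_SVEP_imp_deficiency_le_nullity)
  have finA: "nullity A < \<infinity>" using A by (simp add: left_semi_Fredholm_def)
  have B: "B \<in> left_semi_Fredholm"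
    using MF(1) A le_less_trans[OF dA finA] by (rule upper_triangular_left_semi_Fredholm_imp_second)
  have finB: "nullity B < \<infinity>" using B by (simp add: left_semi_Fredholm_def)
  obtain k where k: "k \<le> nullity B" "nullity ?M + k = nullity A + nullity B"
    "deficiency ?M + k = deficiency A + deficiency B"
    using upper_triangular_nullity_deficiency[of B A C] by blast
  have sum: "nullity A + nullity B \<le> deficiency A + deficiency B"
    unfolding k(2,3)[symmetric] using MF(2) by (rule add_right_mono)
  have "nullity A \<le> deficiency A \<or> deficiency B \<le> nullity B"
    using svep SVEP_imp_nullity_le_deficiency[OF A] dual_SVEP_imp_deficiency_le_nullity[OF B] by blast
  then have "nullity A \<le> deficiency A \<and> nullity B \<le> deficiency B"
    using sum dA finA finB
    by (cases "nullity A"; cases "deficiency A"; cases "nullity B"; cases "deficiency B") auto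
  then show ?thesis using A B by (simp add: left_semi_Weyl_iff)
qed

lemma SVEP_at_shift:
  assumes "SVEP_at T l"
  shows "SVEP_at (T - l *\<^sub>C cid) 0"
proof -
  obtain r where r: "r > 0" and uniq: "\<forall>V f. open V \<and> V \<subseteq> ball l r \<and> vanalytic_on f V \<and>
      (\<forall>\<mu>\<in>V. cblinfun_apply (T - \<mu> *\<^sub>C cid) (f \<mu>) = 0) \<longrightarrow> (\<forall>\<mu>\<in>V. f \<mu> = 0)"
    using assms unfolding SVEP_at_def by blast
  have "f \<mu> = 0" if V: "open V" "V \<subseteq> ball 0 r" "vanalytic_on f V"
    and f: "\<forall>\<mu>\<in>V. cblinfun_apply (T - l *\<^sub>C cid - \<mu> *\<^sub>C cid) (f \<mu>) = 0" and \<mu>: "\<mu> \<in> V" for V f \<mu>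
  proof -
    have "open ((+) l ` V)" using V(1) by (rule open_translation)
    moreover have "(+) l ` V \<subseteq> ball l r" using V(2) by (auto simp: dist_norm)
    moreover have "vanalytic_on (\<lambda>\<nu>. f (\<nu> - l)) ((+) l ` V)"
      unfolding vanalytic_on_def
    proof
      fix \<nu> assume "\<nu> \<in> (+) l ` V"
      then obtain d where d: "(f has_derivative (\<lambda>h. h *\<^sub>C d)) (at (\<nu> - l))"
        using V(3) by (auto simp: vanalytic_on_def)
      have "((\<lambda>\<nu>. \<nu> - l) has_derivative (\<lambda>h. h)) (at \<nu>)"
        by (auto intro!: derivative_eq_intros)
      from has_derivative_compose[OF this d]
      show "\<exists>d. ((\<lambda>\<nu>. f (\<nu> - l)) has_derivative (\<lambda>h. h *\<^sub>C d)) (at \<nu>)" by blast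
    qed
    moreover have "\<forall>\<nu>\<in>(+) l ` V. cblinfun_apply (T - \<nu> *\<^sub>C cid) (f (\<nu> - l)) = 0"
      using f by (simp add: scaleC_add_left diff_diff_eq)
    ultimately have "\<forall>\<nu>\<in>(+) l ` V. f (\<nu> - l) = 0" using uniq by blast
    then show ?thesis using \<mu> by simp
  qed
  then show ?thesis unfolding SVEP_at_def using r by blast
qed

lemma dual_op_shift: "dual_op (T - l *\<^sub>C cid) = dual_op T - l *\<^sub>C cid"
  by (intro cblinfun_eqI) (simp add: dual_op_apply cblinfun_apply_simps cid_apply cblinfun_linear cblinfun_scaleC)

lemma upper_triangular_shift:
  fixes A :: "'x::complex_normed_vector \<Rightarrow>\<^sub>C\<^sub>L 'x" and B :: "'y::complex_normed_vector \<Rightarrow>\<^sub>C\<^sub>L 'y"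
  shows "upper_triangular A C B - l *\<^sub>C cid = upper_triangular (A - l *\<^sub>C cid) C (B - l *\<^sub>C cid)"
proof (rule cblinfun_eqI)
  fix p :: "'x \<times> 'y"
  obtain x y where "p = (x, y)" by (cases p)
  then show "cblinfun_apply (upper_triangular A C B - l *\<^sub>C cid) p
      = cblinfun_apply (upper_triangular (A - l *\<^sub>C cid) C (B - l *\<^sub>C cid)) p"
    by (simp add: upper_triangular_apply cblinfun_apply_simps cid_apply scaleC_prod_def)
qed

theorem theorem3p5:
  fixes A :: "'x::cbanach \<Rightarrow>\<^sub>C\<^sub>L 'x"
    and B :: "'y::cbanach \<Rightarrow>\<^sub>C\<^sub>L 'y"
    and C :: "'y \<Rightarrow>\<^sub>C\<^sub>L 'x"
  assumes "cedim (UNIV :: 'x set) = \<infinity>"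
    and "cedim (UNIV :: 'y set) = \<infinity>"
  shows "left_semi_Weyl_spectrum (upper_triangular A C B)
      \<union> (SVEP_failure A \<inter> SVEP_failure (dual_op B)) \<union> SVEP_failure (dual_op A)
    = left_semi_Weyl_spectrum A \<union> left_semi_Weyl_spectrum B
      \<union> (SVEP_failure A \<inter> SVEP_failure (dual_op B)) \<union> SVEP_failure (dual_op A)"
proof -
  have "l \<in> left_semi_Weyl_spectrum (upper_triangular A C B)
      \<longleftrightarrow> l \<in> left_semi_Weyl_spectrum A \<union> left_semi_Weyl_spectrum B"
    if l: "l \<notin> (SVEP_failure A \<inter> SVEP_failure (dual_op B)) \<union> SVEP_failure (dual_op A)" for l
  proof -
    let ?A = "A - l *\<^sub>C cid" and ?B = "B - l *\<^sub>C cid"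
    have "SVEP_at (dual_op ?A) 0"
      using l SVEP_at_shift[of "dual_op A" l] by (auto simp: SVEP_failure_def dual_op_shift)
    moreover have "SVEP_at ?A 0 \<or> SVEP_at (dual_op ?B) 0"
      using l SVEP_at_shift[of A l] SVEP_at_shift[of "dual_op B" l]
      by (auto simp: SVEP_failure_def dual_op_shift)
    ultimately have "upper_triangular ?A C ?B \<in> left_semi_Weyl
        \<longleftrightarrow> ?A \<in> left_semi_Weyl \<and> ?B \<in> left_semi_Weyl"
      using upper_triangular_left_semi_Weyl upper_triangular_left_semi_Weyl_converse by blast
    then show ?thesis by (simp add: left_semi_Weyl_spectrum_def upper_triangular_shift)
  qed
  then show ?thesis by blast
qed


end
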